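(* One has $$P\big(\Lambda(\omega)\text{ is universal interpolating for }\mathcal{D}\big)=1\quad\text{if and only if}\quad \sum_{n\ge1} n^{-1}N_n<\infty,$$ and $$P\big(\Lambda(\omega)\text{ is universal interpolating for }\mathcal{D}\big)=0\quad\text{if and only if}\quad \sum_{n\ge1} n^{-1}N_n=\infty.$$
   Context: $\mathbb{D}$ is the open unit disk. Random sequence: $(\rho_n)\subset[0,1)$ is a fixed (deterministic) sequence of radii, $(\theta_n(\omega))$ is a sequence of independent random variables, all uniformly distributed on $[0,2\pi]$, and $\Lambda(\omega)=\{\lambda_n\}$ is the set of points $\lambda_n=\rho_n e^{i\theta_n(\omega)}$. For $n=0,1,2,\ldots$, $N_n=\#\{\lambda\in\Lambda(\omega): 1-2^{-n}\le|\lambda|<1-2^{-n-1}\}$; almost surely this depends only on the radii. It is assumed that every $N_n$ ($n\ge 0$) is finite. $\mathcal{D}=\mathcal{D}_1$ is the classical Dirichlet space of analytic functions $f$ on $\mathbb{D}$ with $\|f\|^2=|f(0)|^2+\int_{\mathbb{D}}|f'|^2\,dA<\infty$, $dA=dx\,dy/\pi$, with reproducing kernel (for an equivalent norm) $k_z(w)=\frac{1}{\overline{z}w}\log\frac{1}{1-\overline{z}w}$ (equal to $1$ when $\overline{z}w=0$), and $\|k_\lambda\|^2=k_\lambda(\lambda)$. A set $\Lambda$ of distinct points of $\mathbb{D}$ is universal interpolating for $\mathcal{D}$ if the map $R_\Lambda: f\mapsto (f(\lambda)/\|k_\lambda\|)_{\lambda\in\Lambda}$ is well defined from $\mathcal{D}$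 into $\ell^2(\Lambda)$ and is onto $\ell^2(\Lambda)$. *)

theory Defs
  imports "HOL-Complex_Analysis.Complex_Analysis" "HOL-Probability.Probability"
begin

section \<open>The classical Dirichlet space\<close>

text \<open>On \<^typ>\<open>complex\<close>, \<^const>\<open>lborel\<close> is area measure \<open>dx dy\<close>, so the normalisation
  \<open>dA = dx dy / \<pi>\<close> gives the factor \<open>1 / \<pi>\<close>.\<close>

definition dirichlet_sqnorm :: "(complex \<Rightarrow> complex) \<Rightarrow> ennreal" where
  "dirichlet_sqnorm f =
     ennreal ((cmod (f 0))\<^sup>2)
     + (\<integral>\<^sup>+ z \<in> ball 0 1. ennreal ((cmod (deriv f z))\<^sup>2 / pi) \<partial>lborel)"

definition dirichlet_space :: "(complex \<Rightarrow> complex) set" where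
  "dirichlet_space = {f. f holomorphic_on ball 0 1 \<and> dirichlet_sqnorm f < \<infinity>}"

text \<open>For \<open>z\<close>, \<open>w\<close> in the unit disk, \<open>1 / (1 - cnj z * w)\<close> has positive real part, so the principal
  branch \<^const>\<open>Ln\<close> is the holomorphic logarithm vanishing at \<open>cnj z * w = 0\<close>.\<close>

definition dirichlet_kernel :: "complex \<Rightarrow> complex \<Rightarrow> complex" where
  "dirichlet_kernel z w =
     (if cnj z * w = 0 then 1 else 1 / (cnj z * w) * Ln (1 / (1 - cnj z * w)))"

text \<open>The value \<open>k\<^sub>z(z)\<close> is real and positive for \<open>z\<close> in the unit disk.\<close>

definition kernel_norm :: "complex \<Rightarrow> real" where
  "kernel_norm z = sqrt (Re (dirichlet_kernel z z))"


section \<open>Universal interpolation\<close>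

text \<open>Elements of \<open>\<ell>\<^sup>2(L)\<close> are represented by total functions of which only the values on \<open>L\<close>
  matter.\<close>

definition ell2 :: "complex set \<Rightarrow> (complex \<Rightarrow> complex) set" where
  "ell2 L = {a. (\<lambda>z. (cmod (a z))\<^sup>2) summable_on L}"

definition restriction_op :: "(complex \<Rightarrow> complex) \<Rightarrow> complex \<Rightarrow> complex" where
  "restriction_op f = (\<lambda>z. f z / complex_of_real (kernel_norm z))"

definition universal_interpolating :: "complex set \<Rightarrow> bool" where
  "universal_interpolating L \<longleftrightarrow>
     L \<subseteq> ball 0 1 \<and>
     (\<forall>f\<in>dirichlet_space. restriction_op f \<in> ell2 L) \<and>
     (\<forall>a\<in>ell2 L. \<exists>f\<in>dirichlet_space. \<forall>z\<in>L. restriction_op f z = a z)"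


section \<open>Random sequences with prescribed radii\<close>

definition random_point :: "(nat \<Rightarrow> real) \<Rightarrow> (nat \<Rightarrow> 'a \<Rightarrow> real) \<Rightarrow> 'a \<Rightarrow> nat \<Rightarrow> complex" where
  "random_point \<rho> \<theta> \<omega> k = complex_of_real (\<rho> k) * cis (\<theta> k \<omega>)"

definition random_set :: "(nat \<Rightarrow> real) \<Rightarrow> (nat \<Rightarrow> 'a \<Rightarrow> real) \<Rightarrow> 'a \<Rightarrow> complex set" where
  "random_set \<rho> \<theta> \<omega> = range (random_point \<rho> \<theta> \<omega>)"

definition dyadic_interval :: "nat \<Rightarrow> real set" where
  "dyadic_interval n = {1 - 1 / 2 ^ n ..< 1 - 1 / 2 ^ (n + 1)}"

definition dyadic_annulus :: "nat \<Rightarrow> complex set" where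
  "dyadic_annulus n = {z. cmod z \<in> dyadic_interval n}"

text \<open>The number \<open>N\<^sub>n\<close>, read off from the radii. The lemma \<open>AE_annulus_count\<close> below shows that for
  \<open>n \<ge> 1\<close> it is almost surely the number of points of the random set in the \<open>n\<close>-th annulus (the
  index set and the point set being finite simultaneously). For \<open>n = 0\<close> this could fail, but only
  because several vanishing radii produce the same point \<open>0\<close>.\<close>

definition annulus_count :: "(nat \<Rightarrow> real) \<Rightarrow> nat \<Rightarrow> nat" where
  "annulus_count \<rho> n = card {k. \<rho> k \<in> dyadic_interval n}"

lemma AE_random_point_distinct:
  fixes M :: "'a measure" and \<rho> :: "nat \<Rightarrow> real" and \<theta> :: "nat \<Rightarrow> 'a \<Rightarrow> real"
  assumes M: "prob_space M"
    and ind: "prob_space.indep_vars M (\<lambda>_. borel) \<theta> UNIV"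
    and unif: "\<And>k. distr M lborel (\<theta> k) = uniform_measure lborel {0..2*pi}"
    and pos: "\<And>k. 0 \<le> \<rho> k"
  shows "AE \<omega> in M. inj_on (random_point \<rho> \<theta> \<omega>) {k. 0 < \<rho> k}"
proof -
  interpret prob_space M by (rule M)
  have rv: "\<theta> k \<in> borel_measurable M" for k
    using ind unfolding indep_vars_def by auto
  have shift: "AE \<omega> in M. \<theta> j \<omega> \<noteq> \<theta> k \<omega> + c" if "j \<noteq> k" for j k and c :: real
  proof -
    let ?Q = "\<lambda>k. distr M borel (\<theta> k)"
    have Q: "?Q i = uniform_measure lborel {0..2*pi}" for i
    proof -
      have "?Q i = distr M lborel (\<theta> i)" by (rule distr_cong) auto
      thus ?thesis using unif by simp
    qed
    interpret Qj: prob_space "?Q j" by (rule prob_space_distr[OF rv])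
    interpret Qk: prob_space "?Q k" by (rule prob_space_distr[OF rv])
    interpret Qjk: pair_sigma_finite "?Q j" "?Q k" by unfold_locales
    have iv: "indep_var borel (\<theta> j) borel (\<theta> k)"
    proof -
      have "indep_var (PiM {j} (\<lambda>_. borel)) (\<lambda>\<omega>. restrict (\<lambda>i. \<theta> i \<omega>) {j})
              (PiM {k} (\<lambda>_. borel)) (\<lambda>\<omega>. restrict (\<lambda>i. \<theta> i \<omega>) {k})"
        using that by (intro indep_var_restrict[OF ind]) auto
      hence "indep_var borel ((\<lambda>f. f j) \<circ> (\<lambda>\<omega>. restrict (\<lambda>i. \<theta> i \<omega>) {j}))
              borel ((\<lambda>f. f k) \<circ> (\<lambda>\<omega>. restrict (\<lambda>i. \<theta> i \<omega>) {k}))"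
        by (rule indep_var_compose) auto
      thus ?thesis by (simp add: comp_def)
    qed
    have joint: "?Q j \<Otimes>\<^sub>M ?Q k = distr M (borel \<Otimes>\<^sub>M borel) (\<lambda>\<omega>. (\<theta> j \<omega>, \<theta> k \<omega>))"
      using iv indep_var_distribution_eq by blast
    have "AE x in ?Q j. AE y in ?Q k. x \<noteq> y + c"
    proof (rule AE_I2)
      fix x
      have "AE y in lborel. y \<noteq> x - c" by (rule AE_lborel_singleton)
      hence "AE y in lborel. x \<noteq> y + c" by eventually_elim auto
      thus "AE y in ?Q k. x \<noteq> y + c"
        unfolding Q by (intro AE_uniform_measureI) (auto elim: AE_mp)
    qed
    moreover have "Measurable.pred (?Q j \<Otimes>\<^sub>M ?Q k) (\<lambda>p. fst p \<noteq> snd p + c)"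
      by measurable
    ultimately have "AE p in ?Q j \<Otimes>\<^sub>M ?Q k. fst p \<noteq> snd p + c"
      by (intro Qjk.AE_pair_measure) (auto simp: pred_def)
    hence "AE p in distr M (borel \<Otimes>\<^sub>M borel) (\<lambda>\<omega>. (\<theta> j \<omega>, \<theta> k \<omega>)). fst p \<noteq> snd p + c"
      unfolding joint .
    from AE_distrD[OF _ this] show ?thesis using rv by auto
  qed
  have "AE \<omega> in M. \<forall>j k. \<forall>m::int. j \<noteq> k \<longrightarrow> \<theta> j \<omega> \<noteq> \<theta> k \<omega> + 2 * pi * of_int m"
    unfolding AE_all_countable using shift by auto
  thus ?thesis
  proof eventually_elim
    fix \<omega>
    assume *: "\<forall>j k. \<forall>m::int. j \<noteq> k \<longrightarrow> \<theta> j \<omega> \<noteq> \<theta> k \<omega> + 2 * pi * of_int m"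
    show "inj_on (random_point \<rho> \<theta> \<omega>) {k. 0 < \<rho> k}"
    proof (rule inj_onI, rule ccontr)
      fix j k
      assume jk: "j \<in> {k. 0 < \<rho> k}" "k \<in> {k. 0 < \<rho> k}"
        and eq: "random_point \<rho> \<theta> \<omega> j = random_point \<rho> \<theta> \<omega> k" and ne: "j \<noteq> k"
      from eq have "cmod (random_point \<rho> \<theta> \<omega> j) = cmod (random_point \<rho> \<theta> \<omega> k)" by simp
      hence "\<rho> j = \<rho> k" using jk by (simp add: random_point_def norm_mult)
      with eq jk have "cis (\<theta> j \<omega>) = cis (\<theta> k \<omega>)" by (simp add: random_point_def)
      hence "sin (\<theta> j \<omega>) = sin (\<theta> k \<omega>) \<and> cos (\<theta> j \<omega>) = cos (\<theta> k \<omega>)"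
        by (simp add: complex_eq_iff)
      then obtain m :: int where "\<theta> j \<omega> = \<theta> k \<omega> + 2 * pi * of_int m"
        by (metis sin_cos_eq_iff mult.commute mult.left_commute)
      with * ne show False by blast
    qed
  qed
qed

lemma AE_annulus_count:
  fixes M :: "'a measure" and \<rho> :: "nat \<Rightarrow> real" and \<theta> :: "nat \<Rightarrow> 'a \<Rightarrow> real"
  assumes "prob_space M"
    and "prob_space.indep_vars M (\<lambda>_. borel) \<theta> UNIV"
    and "\<And>k. distr M lborel (\<theta> k) = uniform_measure lborel {0..2*pi}"
    and pos: "\<And>k. 0 \<le> \<rho> k"
  shows "AE \<omega> in M. \<forall>n\<ge>1.
           (finite (random_set \<rho> \<theta> \<omega> \<inter> dyadic_annulus n) \<longleftrightarrow> finite {k. \<rho> k \<in> dyadic_interval n}) \<and>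
           card (random_set \<rho> \<theta> \<omega> \<inter> dyadic_annulus n) = annulus_count \<rho> n"
  using AE_random_point_distinct[OF assms]
proof eventually_elim
  fix \<omega>
  assume inj: "inj_on (random_point \<rho> \<theta> \<omega>) {k. 0 < \<rho> k}"
  have norm: "cmod (random_point \<rho> \<theta> \<omega> k) = \<rho> k" for k
    using pos[of k] by (simp add: random_point_def norm_mult)
  show "\<forall>n\<ge>1.
      (finite (random_set \<rho> \<theta> \<omega> \<inter> dyadic_annulus n) \<longleftrightarrow> finite {k. \<rho> k \<in> dyadic_interval n}) \<and>
      card (random_set \<rho> \<theta> \<omega> \<inter> dyadic_annulus n) = annulus_count \<rho> n"
  proof (intro allI impI)
    fix n :: nat
    assume n: "n \<ge> 1"
    have im: "random_set \<rho> \<theta> \<omega> \<inter> dyadic_annulus n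
        = random_point \<rho> \<theta> \<omega> ` {k. \<rho> k \<in> dyadic_interval n}"
      by (auto simp: random_set_def dyadic_annulus_def norm)
    have "(0::real) < 1 - 1 / 2 ^ n" using n by (simp add: field_simps)
    hence "0 < \<rho> k" if "\<rho> k \<in> dyadic_interval n" for k
      using that unfolding dyadic_interval_def atLeastLessThan_iff by linarith
    hence "{k. \<rho> k \<in> dyadic_interval n} \<subseteq> {k. 0 < \<rho> k}" by blast
    hence inj': "inj_on (random_point \<rho> \<theta> \<omega>) {k. \<rho> k \<in> dyadic_interval n}"
      using inj inj_on_subset by blast
    show "(finite (random_set \<rho> \<theta> \<omega> \<inter> dyadic_annulus n)
            \<longleftrightarrow> finite {k. \<rho> k \<in> dyadic_interval n}) \<and>
          card (random_set \<rho> \<theta> \<omega> \<inter> dyadic_annulus n) = annulus_count \<rho> n"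
      unfolding im annulus_count_def
      using finite_image_iff[OF inj'] card_image[OF inj'] by simp
  qed
qed

end

theory Submission
  imports Defs
begin

text \<open>
  Write \<open>k\<^sub>z\<close> for the reproducing kernel and \<open>G(x,y) = k\<^sub>y(x) / (\<parallel>k\<^sub>x\<parallel> \<parallel>k\<^sub>y\<parallel>)\<close> for the Gram matrix of
  the normalised kernels at the points of \<open>\<Lambda>\<close>. Everything rests on a second moment computation. For
  independent uniform arguments, Parseval on the circle gives
  \<open>E |k\<^sub>y(x)|\<^sup>2 = \<Sum>\<^sub>n (|x| |y|)\<^bsup>2n\<^esup> / (n+1)\<^sup>2 \<le> \<Sum>\<^sub>n 1 / (n+1)\<^sup>2\<close>
  (\<open>kernel_second_moment_le\<close>). The expected squared Hilbert-Schmidt norm of the off-diagonal part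
  of \<open>G\<close> is therefore at most a constant times \<open>(\<Sum>\<^sub>\<lambda> 1 / \<parallel>k\<^sub>\<lambda>\<parallel>\<^sup>2)\<^sup>2\<close>. On the \<open>n\<close>-th annulus \<open>\<parallel>k\<^sub>\<lambda>\<parallel>\<^sup>2\<close>
  is comparable with \<open>n\<close>, so \<open>\<Sum>\<^sub>\<lambda> 1 / \<parallel>k\<^sub>\<lambda>\<parallel>\<^sup>2\<close> and \<open>\<Sum>\<^sub>n N\<^sub>n / n\<close> converge together
  (\<open>annulus_count_series_finite_iff\<close>).

  If the series converges, \<open>G\<close> is almost surely a Hilbert-Schmidt perturbation of the identity.
  Deleting finitely many points brings the Hilbert-Schmidt norm of the perturbation below 1. Then
  \<open>G\<close> is bounded and invertible on \<open>\<ell>\<^sup>2\<close>, the inverse being a Neumann series, and the normalised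
  kernels form a Riesz sequence. Boundedness says that the restriction operator maps into \<open>\<ell>\<^sup>2\<close>
  (\<open>bessel_inequality\<close>), invertibility that it is onto (\<open>moment_problem_solvable\<close>). A deleted
  point \<open>p\<close> is put back by looking for interpolants of the form \<open>b + (z - p) h(z)\<close>
  (\<open>universal_interpolating_insert\<close>).

  If the series diverges, the constant function 1 already prevents the restriction operator from
  mapping into \<open>\<ell>\<^sup>2\<close>: its image has squared norm \<open>\<Sum>\<^sub>\<lambda> 1 / \<parallel>k\<^sub>\<lambda>\<parallel>\<^sup>2\<close>.

  The Hilbert space arguments are carried out on Taylor coefficients. A power series
  \<open>\<Sum>\<^sub>n a\<^sub>n z\<^sup>n\<close> is in the Dirichlet space iff \<open>\<Sum>\<^sub>n (n+1) |a\<^sub>n|\<^sup>2 < \<infinity>\<close>, and \<open>\<Sum>\<^sub>n (n+1) |a\<^sub>n|\<^sup>2\<close> is the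
  squared norm for which \<open>k\<close> is the reproducing kernel. The equivalence comes from Parseval on the
  disc, that is Parseval on circles together with the rotation invariance of area.
\<close>

section \<open>Parseval on circles and discs\<close>

text \<open>Measures of images under orthogonal maps are computed in \<open>real^'n\<close>; this isometry with the plane
  \<open>real^2\<close> transfers the result to \<open>complex\<close>.\<close>

definition complex_to_vec :: "complex \<Rightarrow> real^2" where
  "complex_to_vec z = (\<chi> i. if i = 1 then Re z else Im z)"

definition vec_to_complex :: "real^2 \<Rightarrow> complex" where
  "vec_to_complex v = Complex (vec_nth v 1) (vec_nth v 2)"

lemma vec_to_complex_inverse [simp]: "complex_to_vec (vec_to_complex v) = v"
  by (auto simp: complex_to_vec_def vec_to_complex_def vec_eq_iff forall_2)

lemma complex_to_vec_inverse [simp]: "vec_to_complex (complex_to_vec z) = z"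
  by (auto simp: complex_to_vec_def vec_to_complex_def)

lemma linear_vec_to_complex: "linear vec_to_complex"
  by (auto simp: linear_iff vec_to_complex_def complex_eq_iff)

lemma linear_complex_to_vec: "linear complex_to_vec"
  by (auto simp: linear_iff complex_to_vec_def vec_eq_iff forall_2)

lemma measurable_vec_to_complex [measurable]: "vec_to_complex \<in> borel \<rightarrow>\<^sub>M borel"
  using linear_vec_to_complex
  by (intro borel_measurable_continuous_onI linear_continuous_on linear_conv_bounded_linear[THEN iffD1])

lemma measurable_complex_to_vec [measurable]: "complex_to_vec \<in> borel \<rightarrow>\<^sub>M borel"
  using linear_complex_to_vec
  by (intro borel_measurable_continuous_onI linear_continuous_on linear_conv_bounded_linear[THEN iffD1])

lemma norm_complex_to_vec: "norm (complex_to_vec z) = cmod z"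
  by (simp add: norm_vec_def L2_set_def sum_2 complex_to_vec_def cmod_def)

text \<open>Lebesgue measure is determined by its values on boxes, and the isometry maps boxes to boxes with
  the same side lengths.\<close>

lemma distr_lborel_vec_to_complex: "distr lborel borel vec_to_complex = lborel"
proof (rule lborel_eqI[symmetric])
  fix l u :: complex
  assume lu: "\<And>b. b \<in> Basis \<Longrightarrow> l \<bullet> b \<le> u \<bullet> b"
  have le: "Re l \<le> Re u" "Im l \<le> Im u"
    using lu[of 1] lu[of \<i>] by (auto simp: Basis_complex_def inner_complex_def)
  have "vec_to_complex -` box l u = box (complex_to_vec l) (complex_to_vec u)"
    by (auto simp: box_def Basis_complex_def inner_complex_def vec_to_complex_def complex_to_vec_def
        Basis_vec_def inner_axis forall_2)
  hence "emeasure (distr lborel borel vec_to_complex) (box l u)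
      = emeasure lborel (box (complex_to_vec l) (complex_to_vec u))"
    by (simp add: emeasure_distr)
  also have "\<dots> = (\<Prod>b\<in>Basis. (complex_to_vec u - complex_to_vec l) \<bullet> b)"
    using le by (intro emeasure_lborel_box)
       (auto simp: Basis_vec_def inner_axis complex_to_vec_def)
  also have "(\<Prod>b\<in>(Basis :: (real^2) set). (complex_to_vec u - complex_to_vec l) \<bullet> b)
      = (\<Prod>i\<in>(UNIV::2 set). vec_nth (complex_to_vec u - complex_to_vec l) i)"
    by (rule prod.reindex_bij_witness[of _ "\<lambda>i. axis i 1" "\<lambda>b. THE i. b = axis i (1::real)"])
       (auto simp: Basis_vec_def inner_axis axis_eq_axis)
  also have "\<dots> = (\<Prod>b\<in>Basis. (u - l) \<bullet> b)"
    by (simp add: UNIV_2 complex_to_vec_def Basis_complex_def inner_complex_def)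
  finally show "emeasure (distr lborel borel vec_to_complex) (box l u) = (\<Prod>b\<in>Basis. (u - l) \<bullet> b)" .
qed simp

lemma orthogonal_rotation_vec:
  assumes "cmod c = 1"
  shows "orthogonal_transformation (\<lambda>v. complex_to_vec (c * vec_to_complex v))"
proof -
  have "linear (\<lambda>v. complex_to_vec (c * vec_to_complex v))"
    using linear_compose[OF linear_compose[OF linear_vec_to_complex, of "(*) c"] linear_complex_to_vec]
    by (simp add: o_def linear_times)
  moreover have "norm (complex_to_vec (c * vec_to_complex v)) = norm v" for v
    using assms by (metis norm_complex_to_vec norm_mult mult_1 vec_to_complex_inverse)
  ultimately show ?thesis by (simp add: orthogonal_transformation)
qed

text \<open>Multiplication by a unimodular number corresponds to an orthogonal map of the plane, so preimages
  of boxes keep their area; boxes determine the measure.\<close>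

lemma distr_lborel_rotation:
  fixes c :: complex
  assumes c: "cmod c = 1"
  shows "distr lborel borel (\<lambda>z. c * z) = lborel"
proof -
  define T where "T = (\<lambda>v. complex_to_vec (c * vec_to_complex v))"
  define S where "S = (\<lambda>v. complex_to_vec (cnj c * vec_to_complex v))"
  have cc: "c * cnj c = 1" using c by (simp add: complex_norm_square[symmetric])
  have TS: "T (S v) = v" "S (T v) = v" for v
    unfolding T_def S_def complex_to_vec_inverse mult.assoc[symmetric] cc
    using cc by (simp_all add: mult.commute)
  have [measurable]: "T \<in> borel \<rightarrow>\<^sub>M borel" unfolding T_def by measurable
  have "distr lborel borel T = lborel"
  proof (rule lborel_eqI[symmetric])
    fix l u :: "real^2"
    assume lu: "\<And>b. b \<in> Basis \<Longrightarrow> l \<bullet> b \<le> u \<bullet> b"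
    have "T -` box l u = S ` box l u"
      using TS by (auto simp: image_iff) (metis TS(2))
    moreover have "T -` box l u \<in> sets borel"
      by (rule measurable_sets_borel[of T borel]) auto
    moreover have S: "orthogonal_transformation S"
      unfolding S_def using c by (intro orthogonal_rotation_vec) simp
    ultimately have "emeasure (distr lborel borel T) (box l u) = emeasure lebesgue (S ` box l u)"
      by (simp add: emeasure_distr)
    also have "\<dots> = measure lebesgue (S ` box l u)"
      by (intro emeasure_eq_measure2 measurable_orthogonal_image[OF S] lmeasurable_box)
    also have "measure lebesgue (S ` box l u) = measure lebesgue (box l u)"
      by (rule measure_orthogonal_image[OF S]) auto
    also have "\<dots> = (\<Prod>b\<in>Basis. (u - l) \<bullet> b)"
      using lu by (simp add: measure_lborel_box)
    finally show "emeasure (distr lborel borel T) (box l u) = (\<Prod>b\<in>Basis. (u - l) \<bullet> b)" .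
  qed simp
  hence "lborel = distr (distr lborel borel T) borel vec_to_complex"
    by (simp add: distr_lborel_vec_to_complex)
  also have "\<dots> = distr lborel borel (vec_to_complex \<circ> T)" by (subst distr_distr) auto
  also have "vec_to_complex \<circ> T = (\<lambda>z. c * z) \<circ> vec_to_complex" by (auto simp: T_def)
  also have "distr lborel borel \<dots> = distr (distr lborel borel vec_to_complex) borel (\<lambda>z. c * z)"
    by (subst distr_distr) auto
  finally show ?thesis by (simp add: distr_lborel_vec_to_complex)
qed

lemma nn_integral_rotation:
  fixes c :: complex
  assumes "cmod c = 1" and [measurable]: "h \<in> borel_measurable borel"
  shows "(\<integral>\<^sup>+z. h (c * z) \<partial>lborel) = (\<integral>\<^sup>+z. h z \<partial>lborel)"
  using nn_integral_distr[of "\<lambda>z. c * z" lborel borel h] distr_lborel_rotation[OF assms(1)] by simp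

lemma integral_cis_multiple:
  fixes k :: int
  shows "(LBINT t:{0..2*pi}. cis (of_int k * t)) = (if k = 0 then of_real (2*pi) else 0)"
proof (cases "k = 0")
  case False
  have "(LBINT t:{0..2*pi}. cis (of_int k * t))
      = cis (of_int k * (2*pi)) / (\<i> * of_int k) - cis (of_int k * 0) / (\<i> * of_int k)"
    unfolding set_lebesgue_integral_def
  proof (rule integral_FTC_Icc)
    fix x :: real
    show "((\<lambda>t. cis (of_int k * t) / (\<i> * of_int k)) has_vector_derivative cis (of_int k * x))
        (at x within {0..2*pi})"
      unfolding cis_conv_exp using False
      by (auto intro!: derivative_eq_intros has_vector_derivative_real_field simp: field_simps)
  qed (auto intro!: continuous_intros)
  moreover have "cis (of_int k * (2*pi)) = 1"
    by (metis cis_multiple_2pi Ints_of_int mult.commute)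
  ultimately show ?thesis using False by simp
qed (simp add: set_lebesgue_integral_def scaleR_conv_of_real)

lemma summable_power2:
  fixes f :: "nat \<Rightarrow> real"
  assumes f: "summable f" and pos: "\<And>n. 0 \<le> f n"
  shows "summable (\<lambda>n. (f n)\<^sup>2)"
proof (rule summable_comparison_test_ev[OF _ f])
  have "eventually (\<lambda>n. f n < 1) sequentially"
    using summable_LIMSEQ_zero[OF f] by (rule order_tendstoD) simp
  thus "eventually (\<lambda>n. norm ((f n)\<^sup>2) \<le> f n) sequentially"
    by eventually_elim (use pos in \<open>auto simp: power2_eq_square intro: mult_left_le\<close>)
qed

lemma borel_measurable_cis [measurable]: "cis \<in> borel_measurable borel"
  by (intro borel_measurable_continuous_onI continuous_intros)

text \<open>Partial sums satisfy the identity because the characters of the circle are orthogonal. Absolute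
  summability gives a uniform bound, so the limit passes under the integral.\<close>

lemma circle_parseval:
  fixes b :: "nat \<Rightarrow> complex"
  assumes b: "summable (\<lambda>n. cmod (b n))"
  shows "(LBINT t:{0..2*pi}. (cmod (\<Sum>n. b n * cis (n * t)))\<^sup>2) = 2*pi * (\<Sum>n. (cmod (b n))\<^sup>2)"
proof -
  define B where "B = (\<Sum>n. cmod (b n))"
  define S where "S = (\<lambda>N t. \<Sum>n<N. b n * cis (real n * t))"
  have bs: "summable (\<lambda>n. b n * cis (real n * t))" for t
    by (rule summable_norm_cancel) (simp add: norm_mult b)
  have S_int: "(LBINT t:{0..2*pi}. (cmod (S N t))\<^sup>2) = 2*pi * (\<Sum>n<N. (cmod (b n))\<^sup>2)" for N
  proof -
    have "complex_of_real (LBINT t:{0..2*pi}. (cmod (S N t))\<^sup>2)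
        = (LBINT t:{0..2*pi}. complex_of_real ((cmod (S N t))\<^sup>2))"
      by (rule set_integral_complex_of_real[symmetric])
    also have "\<dots> = (LBINT t:{0..2*pi}. (\<Sum>n<N. \<Sum>m<N. b n * cnj (b m) * cis (of_int (int n - int m) * t)))"
    proof (intro set_lebesgue_integral_cong ballI allI impI)
      fix t :: real
      have "complex_of_real ((cmod (S N t))\<^sup>2) = S N t * cnj (S N t)" by (rule complex_norm_square)
      also have "\<dots> = (\<Sum>n<N. \<Sum>m<N. b n * cis (real n * t) * (cnj (b m) * cis (- (real m * t))))"
        by (simp add: S_def sum_product cis_cnj)
      also have "\<dots> = (\<Sum>n<N. \<Sum>m<N. b n * cnj (b m) * cis (of_int (int n - int m) * t))"
      proof (intro sum.cong refl)
        fix n m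
        have "cis (of_int (int n - int m) * t) = cis (real n * t) * cis (- (real m * t))"
          by (simp add: cis_mult algebra_simps)
        thus "b n * cis (real n * t) * (cnj (b m) * cis (- (real m * t)))
            = b n * cnj (b m) * cis (of_int (int n - int m) * t)" by simp
      qed
      finally show "complex_of_real ((cmod (S N t))\<^sup>2)
          = (\<Sum>n<N. \<Sum>m<N. b n * cnj (b m) * cis (of_int (int n - int m) * t))" .
    qed simp
    also have "\<dots> = (\<Sum>n<N. \<Sum>m<N. b n * cnj (b m) * (LBINT t:{0..2*pi}. cis (of_int (int n - int m) * t)))"
    proof -
      have int: "integrable lborel (\<lambda>t. indicator {0..2*pi} t *\<^sub>R
          (b n * cnj (b m) * cis (of_int (int n - int m) * t)))" for n m
        by (intro borel_integrable_compact) (auto intro!: continuous_intros)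
      have "(LBINT t:{0..2*pi}. (\<Sum>n<N. \<Sum>m<N. b n * cnj (b m) * cis (of_int (int n - int m) * t)))
          = (\<Sum>n<N. \<Sum>m<N. LBINT t:{0..2*pi}. b n * cnj (b m) * cis (of_int (int n - int m) * t))"
        unfolding set_lebesgue_integral_def scaleR_sum_right
        by (simp only: Bochner_Integration.integral_sum Bochner_Integration.integrable_sum int)
      thus ?thesis by (simp only: set_integral_mult_right)
    qed
    also have "\<dots> = of_real (2*pi) * (\<Sum>n<N. b n * cnj (b n))"
      unfolding integral_cis_multiple by (simp add: if_distrib sum.delta' sum_distrib_left mult_ac cong: if_cong)
    also have "\<dots> = complex_of_real (2*pi * (\<Sum>n<N. (cmod (b n))\<^sup>2))"
      by (simp only: of_real_mult of_real_sum complex_norm_square)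
    finally show ?thesis using of_real_eq_iff by blast
  qed
  have [measurable]: "S N \<in> borel_measurable borel" for N
    unfolding S_def by measurable
  have [measurable]: "(\<lambda>t. \<Sum>n. b n * cis (real n * t)) \<in> borel_measurable borel"
    by (rule borel_measurable_LIMSEQ_metric[of S])
       (measurable, use summable_LIMSEQ[OF bs] in \<open>auto simp: S_def\<close>)
  have "(\<lambda>N. LBINT t:{0..2*pi}. (cmod (S N t))\<^sup>2) \<longlonglongrightarrow> (LBINT t:{0..2*pi}. (cmod (\<Sum>n. b n * cis (n * t)))\<^sup>2)"
    unfolding set_lebesgue_integral_def
  proof (rule integral_dominated_convergence[where w = "\<lambda>t. indicator {0..2*pi} t *\<^sub>R B\<^sup>2"])
    show "AE t in lborel. (\<lambda>N. indicator {0..2*pi} t *\<^sub>R (cmod (S N t))\<^sup>2)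
       \<longlonglongrightarrow> indicator {0..2*pi} t *\<^sub>R (cmod (\<Sum>n. b n * cis (n * t)))\<^sup>2"
      unfolding S_def using summable_LIMSEQ[OF bs] by (auto intro!: tendsto_intros)
    have "cmod (S N t) \<le> B" for N t
    proof -
      have "cmod (S N t) \<le> (\<Sum>n<N. cmod (b n))"
        unfolding S_def by (rule order_trans[OF norm_sum]) (simp add: norm_mult)
      also have "\<dots> \<le> B" unfolding B_def by (rule sum_le_suminf[OF b]) auto
      finally show ?thesis .
    qed
    thus "AE t in lborel. norm (indicator {0..2*pi} t *\<^sub>R (cmod (S N t))\<^sup>2) \<le> indicator {0..2*pi} t *\<^sub>R B\<^sup>2" for N
      by (auto simp: indicator_def intro!: power_mono)
    show "integrable lborel (\<lambda>t. indicator {0..2*pi} t *\<^sub>R B\<^sup>2)"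
      by (intro integrable_scaleR_left integrable_real_indicator) (auto simp: emeasure_lborel_Icc_eq)
    show "(\<lambda>t. indicator {0..2*pi} t *\<^sub>R (cmod (S N t))\<^sup>2) \<in> borel_measurable lborel" for N
      by measurable
    show "(\<lambda>t. indicator {0..2*pi} t *\<^sub>R (cmod (\<Sum>n. b n * cis (real n * t)))\<^sup>2) \<in> borel_measurable lborel"
      by measurable
  qed
  moreover have "(\<lambda>N. LBINT t:{0..2*pi}. (cmod (S N t))\<^sup>2) \<longlonglongrightarrow> 2*pi * (\<Sum>n. (cmod (b n))\<^sup>2)"
    unfolding S_int by (intro tendsto_intros summable_LIMSEQ summable_power2 b) auto
  ultimately show ?thesis by (rule LIMSEQ_unique)
qed

text \<open>The form suited to Tonelli's theorem, which is how both area integrals and expectations reach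
  the circle.\<close>

lemma circle_parseval_nn_integral:
  fixes b :: "nat \<Rightarrow> complex"
  assumes b: "summable (\<lambda>n. cmod (b n))"
  shows "(\<integral>\<^sup>+t\<in>{0..2*pi}. ennreal ((cmod (\<Sum>n. b n * cis (n * t)))\<^sup>2) \<partial>lborel)
      = ennreal (2*pi * (\<Sum>n. (cmod (b n))\<^sup>2))"
proof -
  let ?f = "\<lambda>t. (cmod (\<Sum>n. b n * cis (real n * t)))\<^sup>2"
  have bs: "summable (\<lambda>n. b n * cis (real n * t))" for t
    by (rule summable_norm_cancel) (simp add: norm_mult b)
  have [measurable]: "(\<lambda>t. \<Sum>n. b n * cis (real n * t)) \<in> borel_measurable borel"
    by (rule borel_measurable_LIMSEQ_metric[of "\<lambda>N t. \<Sum>n<N. b n * cis (real n * t)"])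
       (measurable, use summable_LIMSEQ[OF bs] in auto)
  have "cmod (\<Sum>n. b n * cis (real n * t)) \<le> (\<Sum>n. cmod (b n))" for t
    using summable_norm[of "\<lambda>n. b n * cis (real n * t)"] b by (simp add: norm_mult)
  hence int: "integrable lborel (\<lambda>t. indicator {0..2*pi} t *\<^sub>R ?f t)"
    by (intro integrableI_bounded_set_indicator[where B = "(\<Sum>n. cmod (b n))\<^sup>2"] AE_I2 impI)
       (auto simp: emeasure_lborel_Icc_eq intro!: power_mono)
  have "(\<integral>\<^sup>+t\<in>{0..2*pi}. ennreal (?f t) \<partial>lborel) = (\<integral>\<^sup>+t. ennreal (indicator {0..2*pi} t *\<^sub>R ?f t) \<partial>lborel)"
    by (intro nn_integral_cong) (auto simp: indicator_def)
  also have "\<dots> = ennreal (LBINT t:{0..2*pi}. ?f t)"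
    unfolding set_lebesgue_integral_def by (rule nn_integral_eq_integral[OF int]) auto
  finally show ?thesis by (simp only: circle_parseval[OF b])
qed

text \<open>The case \<open>n > 0\<close> replaces polar coordinates by a layer-cake argument. With \<open>m = 2n\<close>, write
  \<open>|z|\<^sup>m\<close> as the integral of \<open>m s\<^bsup>m-1\<^esup>\<close> over \<open>0 \<le> s \<le> |z|\<close> and exchange the integrals. The
  inner integral is then the area \<open>\<pi> (1 - s\<^sup>2)\<close> of an annulus.\<close>

lemma nn_integral_disc_power:
  "(\<integral>\<^sup>+z\<in>ball 0 1. ennreal (cmod z ^ (2 * n)) \<partial>lborel) = ennreal (pi / Suc n)"
proof (cases "n = 0")
  case True
  have "emeasure lborel (ball 0 1 :: complex set) = ennreal pi"
    by (simp add: emeasure_ball unit_ball_vol_2)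
  thus ?thesis using True by simp
next
  case False
  define m where "m = 2 * n"
  have m: "m > 0" using False by (simp add: m_def)
  define H :: "real \<Rightarrow> complex \<Rightarrow> ennreal" where
    "H = (\<lambda>s z. ennreal (real m * s ^ (m - 1)) * indicator {0..cmod z} s * indicator (ball 0 1) z)"
  have H_eq: "H s z = ennreal (real m * s ^ (m - 1)) * (if 0 \<le> s \<and> s \<le> cmod z then 1 else 0)
       * (if cmod z < 1 then 1 else 0)" for s z
    by (auto simp: H_def indicator_def)
  have H_meas: "case_prod H \<in> borel_measurable (lborel \<Otimes>\<^sub>M lborel)"
    unfolding H_eq[abs_def] case_prod_beta by measurable
  have inner_s: "(\<integral>\<^sup>+s. H s z \<partial>lborel) = ennreal (cmod z ^ m) * indicator (ball 0 1) z" for z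
  proof -
    have "(\<integral>\<^sup>+s. H s z \<partial>lborel)
        = (\<integral>\<^sup>+s. ennreal (real m * s ^ (m - 1)) * indicator {0..cmod z} s \<partial>lborel) * indicator (ball 0 1) z"
      unfolding H_def by (rule nn_integral_multc) auto
    also have "(\<integral>\<^sup>+s. ennreal (real m * s ^ (m - 1)) * indicator {0..cmod z} s \<partial>lborel)
        = cmod z ^ m - 0 ^ m"
      by (rule nn_integral_FTC_Icc) (auto intro!: derivative_eq_intros)
    finally show ?thesis using m by (simp add: zero_power)
  qed
  \<comment> \<open>\<open>F\<close> is the antiderivative of \<open>\<pi> m s\<^bsup>m-1\<^esup> (1 - s\<^sup>2)\<close>.\<close>
  define c where "c = real m / real (m + 2)"
  define F where "F = (\<lambda>s. pi * (s ^ m - c * s ^ (m + 2)))"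
  have inner_z: "(\<integral>\<^sup>+z. H s z \<partial>lborel)
      = ennreal (real m * s ^ (m - 1) * (pi * (1 - s\<^sup>2))) * indicator {0..1} s" for s
  proof (cases "s \<in> {0..1}")
    case True
    have sub: "ball 0 s \<subseteq> (ball 0 1 :: complex set)" using True by auto
    have "(\<integral>\<^sup>+z. H s z \<partial>lborel)
        = (\<integral>\<^sup>+z. ennreal (real m * s ^ (m - 1)) * indicator (ball 0 1 - ball 0 s) z \<partial>(lborel :: complex measure))"
      using True by (intro nn_integral_cong) (auto simp: H_def indicator_def)
    also have "\<dots> = ennreal (real m * s ^ (m - 1)) * emeasure lborel (ball 0 1 - ball 0 s :: complex set)"
      by (rule nn_integral_cmult_indicator) auto
    also have "emeasure lborel (ball 0 1 - ball 0 s :: complex set) = ennreal (pi * (1 - s\<^sup>2))"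
      using True by (subst emeasure_Diff[OF _ _ _ sub])
         (auto simp: emeasure_ball unit_ball_vol_2 ennreal_minus algebra_simps)
    finally show ?thesis using True by (simp add: ennreal_mult')
  next
    case False
    hence "H s z = 0" for z by (auto simp: H_def indicator_def)
    thus ?thesis using False by simp
  qed
  have "(\<integral>\<^sup>+z\<in>ball 0 1. ennreal (cmod z ^ m) \<partial>lborel) = (\<integral>\<^sup>+z. \<integral>\<^sup>+s. H s z \<partial>lborel \<partial>lborel)"
    by (simp add: inner_s)
  also have "\<dots> = (\<integral>\<^sup>+s. \<integral>\<^sup>+z. H s z \<partial>lborel \<partial>lborel)"
    by (rule lborel_pair.Fubini'[OF H_meas])
  also have "\<dots> = ennreal (F 1 - F 0)" unfolding inner_z
  proof (rule nn_integral_FTC_Icc[where F = F])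
    fix s :: real assume s: "s \<in> {0..1}"
    have pow: "s ^ (m + 1) = s ^ (m - 1) * s\<^sup>2"
      using m by (cases m) (auto simp: power2_eq_square)
    have "(F has_real_derivative pi * (real m * s ^ (m - 1) - c * (real (m + 2) * s ^ (m + 1)))) (at s)"
      unfolding F_def by (rule derivative_eq_intros refl | simp)+
    moreover have "c * (real (m + 2) * s ^ (m + 1)) = real m * (s ^ (m - 1) * s\<^sup>2)"
      unfolding pow by (simp add: c_def)
    moreover have "pi * (real m * s ^ (m - 1) - real m * (s ^ (m - 1) * s\<^sup>2))
        = real m * s ^ (m - 1) * (pi * (1 - s\<^sup>2))"
      by (simp add: algebra_simps)
    ultimately show "(F has_real_derivative real m * s ^ (m - 1) * (pi * (1 - s\<^sup>2))) (at s)"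
      by metis
    show "0 \<le> real m * s ^ (m - 1) * (pi * (1 - s\<^sup>2))"
      using s by (auto intro!: mult_nonneg_nonneg simp: power_le_one)
  qed auto
  also have "F 1 - F 0 = pi / Suc n"
    using m by (simp add: F_def zero_power c_def) (simp add: m_def field_simps)
  finally show ?thesis by (simp add: m_def)
qed

lemma power_series_disc_abs_summable:
  fixes b :: "nat \<Rightarrow> complex"
  assumes g: "\<And>z. cmod z < 1 \<Longrightarrow> (\<lambda>n. b n * z ^ n) sums g z" and z: "cmod z < 1"
  shows "summable (\<lambda>n. cmod (b n * z ^ n))"
proof -
  obtain r where r: "cmod z < r" "r < 1" using dense z by blast
  hence "0 < r" using norm_ge_zero[of z] by linarith
  with r show ?thesis
    by (intro powser_insidea[of b "of_real r"] sums_summable[OF g]) auto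
qed

text \<open>By rotation invariance the area integral of \<open>|g|\<^sup>2\<close> equals its average over all rotations of \<open>g\<close>.
  Exchanging the two integrals leaves Parseval on the circle through each point of the disc.\<close>

lemma area_parseval:
  fixes b :: "nat \<Rightarrow> complex"
  assumes g: "\<And>z. cmod z < 1 \<Longrightarrow> (\<lambda>n. b n * z ^ n) sums g z"
  shows "(\<integral>\<^sup>+z\<in>ball 0 1. ennreal ((cmod (g z))\<^sup>2) \<partial>lborel)
      = (\<Sum>n. ennreal (pi * (cmod (b n))\<^sup>2 / Suc n))"
proof -
  have hol: "g holomorphic_on ball 0 1"
    by (rule power_series_holomorphic[of _ _ b]) (use g in simp)
  hence cont: "continuous_on (ball 0 1) g" by (rule holomorphic_on_imp_continuous_on)
  have abs_summable: "summable (\<lambda>n. cmod (b n * z ^ n))" if "cmod z < 1" for z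
    using power_series_disc_abs_summable[OF g that] .
  define h where "h = (\<lambda>z. ennreal (indicator (ball 0 1) z *\<^sub>R (cmod (g z))\<^sup>2))"
  have h_eq: "h z = ennreal ((cmod (g z))\<^sup>2) * indicator (ball 0 1) z" for z
    by (auto simp: h_def indicator_def)
  have h_meas [measurable]: "h \<in> borel_measurable borel"
    unfolding h_def using cont
    by (intro measurable_compose[OF _ measurable_ennreal] borel_measurable_continuous_on_indicator)
       (auto intro!: continuous_intros)
  have meas2: "(\<lambda>(t, z). h (cis t * z) * indicator {0..2*pi} t) \<in> borel_measurable (lborel \<Otimes>\<^sub>M lborel)"
  proof -
    show ?thesis unfolding case_prod_beta by measurable
  qed
  have circle: "(\<integral>\<^sup>+t. h (cis t * z) * indicator {0..2*pi} t \<partial>lborel)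
      = (\<Sum>n. ennreal (2 * pi * (cmod (b n))\<^sup>2) * (ennreal (cmod z ^ (2 * n)) * indicator (ball 0 1) z))" for z
  proof (cases "cmod z < 1")
    case True
    have G: "g (cis t * z) = (\<Sum>n. b n * z ^ n * cis (real n * t))" for t :: real
    proof -
      have bz: "b n * (cis t * z) ^ n = b n * z ^ n * cis (real n * t)" for n
        by (simp add: power_mult_distrib flip: Complex.DeMoivre)
      have "(\<lambda>n. b n * (cis t * z) ^ n) sums g (cis t * z)"
        using True by (intro g) (simp add: norm_mult)
      thus ?thesis unfolding bz by (simp add: sums_iff)
    qed
    have "(\<integral>\<^sup>+t. h (cis t * z) * indicator {0..2*pi} t \<partial>lborel)
        = (\<integral>\<^sup>+t\<in>{0..2*pi}. ennreal ((cmod (\<Sum>n. b n * z ^ n * cis (real n * t)))\<^sup>2) \<partial>lborel)"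
      using True by (intro nn_integral_cong) (simp add: h_eq norm_mult G)
    also have "\<dots> = ennreal (2 * pi * (\<Sum>n. (cmod (b n * z ^ n))\<^sup>2))"
      by (rule circle_parseval_nn_integral[OF abs_summable[OF True]])
    also have "2 * pi * (\<Sum>n. (cmod (b n * z ^ n))\<^sup>2) = (\<Sum>n. 2 * pi * (cmod (b n * z ^ n))\<^sup>2)"
      by (rule suminf_mult[symmetric]) (rule summable_power2[OF abs_summable[OF True]], simp)
    also have "ennreal \<dots> = (\<Sum>n. ennreal (2 * pi * (cmod (b n * z ^ n))\<^sup>2))"
      by (rule suminf_ennreal2[symmetric])
         (auto intro!: summable_mult summable_power2 abs_summable[OF True])
    also have "\<dots> = (\<Sum>n. ennreal (2 * pi * (cmod (b n))\<^sup>2) * (ennreal (cmod z ^ (2 * n)) * indicator (ball 0 1) z))"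
      using True by (intro suminf_cong)
        (simp add: norm_mult norm_power power_mult_distrib power_mult[symmetric] mult_ac flip: ennreal_mult)
    finally show ?thesis .
  qed (simp add: h_eq norm_mult)
  have "ennreal (2 * pi) * (\<integral>\<^sup>+z\<in>ball 0 1. ennreal ((cmod (g z))\<^sup>2) \<partial>lborel)
      = (\<integral>\<^sup>+t. (\<integral>\<^sup>+z. h z \<partial>lborel) * indicator {0..2*pi} t \<partial>lborel)"
    unfolding h_eq[symmetric] by (subst nn_integral_cmult_indicator) (auto simp: mult.commute)
  also have "\<dots> = (\<integral>\<^sup>+t. \<integral>\<^sup>+z. h (cis t * z) * indicator {0..2*pi} t \<partial>lborel \<partial>lborel)"
    by (intro nn_integral_cong) (simp add: nn_integral_multc nn_integral_rotation)
  also have "\<dots> = (\<integral>\<^sup>+z. \<integral>\<^sup>+t. h (cis t * z) * indicator {0..2*pi} t \<partial>lborel \<partial>lborel)"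
    by (rule lborel_pair.Fubini'[OF meas2, symmetric])
  also have "\<dots> = (\<Sum>n. ennreal (2 * pi * (cmod (b n))\<^sup>2) * (\<integral>\<^sup>+z\<in>ball 0 1. ennreal (cmod z ^ (2 * n)) \<partial>lborel))"
  proof -
    have [measurable]: "ball 0 1 \<in> sets (borel :: complex measure)" by simp
    have [measurable]: "(\<lambda>z. ennreal (cmod z ^ (2 * n)) * indicator (ball 0 1) z) \<in> borel_measurable lborel" for n
      by measurable
    show ?thesis unfolding circle
      by (subst nn_integral_suminf, measurable) (intro suminf_cong nn_integral_cmult, measurable)
  qed
  also have "\<dots> = (\<Sum>n. ennreal (2 * pi) * ennreal (pi * (cmod (b n))\<^sup>2 / Suc n))"
    unfolding nn_integral_disc_power by (simp add: mult_ac flip: ennreal_mult)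
  also have "\<dots> = ennreal (2 * pi) * (\<Sum>n. ennreal (pi * (cmod (b n))\<^sup>2 / Suc n))"
    by simp
  finally show ?thesis by (subst (asm) ennreal_mult_cancel_left) auto
qed

section \<open>The Dirichlet space in terms of Taylor coefficients\<close>

text \<open>Parseval on the disc, applied to the derivative. The factor \<open>1 / \<pi>\<close> is absorbed by dividing
  the coefficients by \<open>sqrt \<pi>\<close>.\<close>

lemma dirichlet_sqnorm_power_series:
  assumes f: "\<And>z. cmod z < 1 \<Longrightarrow> (\<lambda>n. a n * z ^ n) sums f z"
  shows "dirichlet_sqnorm f = ennreal ((cmod (a 0))\<^sup>2) + (\<Sum>n. ennreal (Suc n * (cmod (a (Suc n)))\<^sup>2))"
proof -
  have f0: "f 0 = a 0" using f[of 0] by (simp add: powser_sums_zero_iff)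
  have sm: "summable (\<lambda>n. a n * z ^ n)" if "norm z < 1" for z using f[OF that] by (rule sums_summable)
  have deriv: "(\<lambda>n. diffs a n * z ^ n) sums deriv f z" if z: "cmod z < 1" for z
  proof -
    have "((\<lambda>z. \<Sum>n. a n * z ^ n) has_field_derivative (\<Sum>n. diffs a n * z ^ n)) (at z)"
      by (rule termdiffs_strong'[OF sm z])
    hence "(f has_field_derivative (\<Sum>n. diffs a n * z ^ n)) (at z)"
      by (rule has_field_derivative_transform_within_open[OF _ open_ball, of _ _ z 0 1])
         (use z f in \<open>auto simp: sums_iff\<close>)
    thus ?thesis using termdiff_converges[OF z sm] by (simp add: DERIV_imp_deriv sums_iff)
  qed
  have "(\<integral>\<^sup>+z\<in>ball 0 1. ennreal ((cmod (deriv f z))\<^sup>2 / pi) \<partial>lborel)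
      = (\<integral>\<^sup>+z\<in>ball 0 1. ennreal ((cmod (deriv f z / sqrt pi))\<^sup>2) \<partial>lborel)"
    by (simp add: norm_divide power_divide)
  also have "\<dots> = (\<Sum>n. ennreal (pi * (cmod (diffs a n / sqrt pi))\<^sup>2 / Suc n))"
    by (rule area_parseval) (use sums_divide[OF deriv] in simp)
  also have "\<dots> = (\<Sum>n. ennreal (Suc n * (cmod (a (Suc n)))\<^sup>2))"
    by (intro suminf_cong)
       (simp add: diffs_def norm_divide norm_mult power_divide power_mult_distrib power2_eq_square
         del: of_nat_Suc)
  finally show ?thesis by (simp add: dirichlet_sqnorm_def f0)
qed

lemma suminf_ennreal_neq_top_iff:
  "(\<And>n. 0 \<le> f n) \<Longrightarrow> (\<Sum>n. ennreal (f n)) \<noteq> top \<longleftrightarrow> summable f"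
  by (metis ennreal_suminf_neq_top summable_suminf_not_top)

text \<open>The weight \<open>n + 1\<close> in place of \<open>n\<close> gives the equivalent norm whose reproducing kernel is the
  Dirichlet kernel.\<close>

lemma power_series_in_dirichlet_space_iff:
  assumes f: "\<And>z. cmod z < 1 \<Longrightarrow> (\<lambda>n. a n * z ^ n) sums f z"
  shows "f \<in> dirichlet_space \<longleftrightarrow> summable (\<lambda>n. Suc n * (cmod (a n))\<^sup>2)"
proof -
  have "f holomorphic_on ball 0 1"
    by (rule power_series_holomorphic[of _ _ a]) (use f in simp)
  hence "f \<in> dirichlet_space \<longleftrightarrow> (\<Sum>n. ennreal (Suc n * (cmod (a (Suc n)))\<^sup>2)) \<noteq> top"
    unfolding dirichlet_space_def by (simp add: dirichlet_sqnorm_power_series[OF f] less_top)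
  also have "(\<Sum>n. ennreal (Suc n * (cmod (a (Suc n)))\<^sup>2)) \<noteq> top \<longleftrightarrow> summable (\<lambda>n. Suc n * (cmod (a (Suc n)))\<^sup>2)"
    by (rule suminf_ennreal_neq_top_iff) simp
  also have "\<dots> \<longleftrightarrow> summable (\<lambda>n. Suc (Suc n) * (cmod (a (Suc n)))\<^sup>2)"
  proof
    assume *: "summable (\<lambda>n. Suc n * (cmod (a (Suc n)))\<^sup>2)"
    show "summable (\<lambda>n. Suc (Suc n) * (cmod (a (Suc n)))\<^sup>2)"
    proof (rule summable_comparison_test'[OF summable_mult[OF *, of 2]])
      fix n show "norm (Suc (Suc n) * (cmod (a (Suc n)))\<^sup>2) \<le> 2 * (Suc n * (cmod (a (Suc n)))\<^sup>2)"
        by (auto simp: mult_right_mono simp flip: mult.assoc)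
    qed
  next
    assume *: "summable (\<lambda>n. Suc (Suc n) * (cmod (a (Suc n)))\<^sup>2)"
    show "summable (\<lambda>n. Suc n * (cmod (a (Suc n)))\<^sup>2)"
      by (rule summable_comparison_test'[OF *]) (auto intro: mult_right_mono)
  qed
  also have "\<dots> \<longleftrightarrow> summable (\<lambda>n. Suc n * (cmod (a n))\<^sup>2)"
    by (rule summable_Suc_iff[of "\<lambda>n. Suc n * (cmod (a n))\<^sup>2"])
  finally show ?thesis .
qed

section \<open>Square-summable families and Hilbert-Schmidt perturbations of the identity\<close>

lemma cauchy_schwarz_infsum:
  fixes f g :: "'a \<Rightarrow> real"
  assumes f: "(\<lambda>x. (f x)\<^sup>2) summable_on A" and g: "(\<lambda>x. (g x)\<^sup>2) summable_on A"
    and pos: "\<And>x. 0 \<le> f x" "\<And>x. 0 \<le> g x"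
  shows "(\<lambda>x. f x * g x) summable_on A"
    and "(\<Sum>\<^sub>\<infinity>x\<in>A. f x * g x) \<le> sqrt (\<Sum>\<^sub>\<infinity>x\<in>A. (f x)\<^sup>2) * sqrt (\<Sum>\<^sub>\<infinity>x\<in>A. (g x)\<^sup>2)"
proof -
  have le: "(\<Sum>x\<in>S. f x * g x) \<le> sqrt (\<Sum>\<^sub>\<infinity>x\<in>A. (f x)\<^sup>2) * sqrt (\<Sum>\<^sub>\<infinity>x\<in>A. (g x)\<^sup>2)"
    if S: "finite S" "S \<subseteq> A" for S
  proof -
    have "(\<Sum>x\<in>S. f x * g x) \<le> L2_set f S * L2_set g S"
      using L2_set_mult_ineq[of f g S] pos by simp
    also have "\<dots> \<le> sqrt (\<Sum>\<^sub>\<infinity>x\<in>A. (f x)\<^sup>2) * sqrt (\<Sum>\<^sub>\<infinity>x\<in>A. (g x)\<^sup>2)"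
      unfolding L2_set_def using S f g
      by (intro mult_mono real_sqrt_le_mono finite_sum_le_infsum) (auto intro: sum_nonneg infsum_nonneg)
    finally show ?thesis .
  qed
  show sm: "(\<lambda>x. f x * g x) summable_on A"
    using le pos by (intro nonneg_bdd_above_summable_on bdd_aboveI2) auto
  show "(\<Sum>\<^sub>\<infinity>x\<in>A. f x * g x) \<le> sqrt (\<Sum>\<^sub>\<infinity>x\<in>A. (f x)\<^sup>2) * sqrt (\<Sum>\<^sub>\<infinity>x\<in>A. (g x)\<^sup>2)"
    by (rule infsum_le_finite_sums[OF sm]) (rule le)
qed

lemma cauchy_schwarz_infsum_complex:
  fixes f g :: "'a \<Rightarrow> complex"
  assumes f: "(\<lambda>x. (cmod (f x))\<^sup>2) summable_on A" and g: "(\<lambda>x. (cmod (g x))\<^sup>2) summable_on A"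
  shows "(\<lambda>x. cmod (f x * g x)) summable_on A" "(\<lambda>x. f x * g x) summable_on A"
    and "(\<Sum>\<^sub>\<infinity>x\<in>A. cmod (f x * g x)) \<le> sqrt (\<Sum>\<^sub>\<infinity>x\<in>A. (cmod (f x))\<^sup>2) * sqrt (\<Sum>\<^sub>\<infinity>x\<in>A. (cmod (g x))\<^sup>2)"
    and "cmod (\<Sum>\<^sub>\<infinity>x\<in>A. f x * g x) \<le> sqrt (\<Sum>\<^sub>\<infinity>x\<in>A. (cmod (f x))\<^sup>2) * sqrt (\<Sum>\<^sub>\<infinity>x\<in>A. (cmod (g x))\<^sup>2)"
proof -
  note cs = cauchy_schwarz_infsum[OF f g norm_ge_zero norm_ge_zero]
  show 1: "(\<lambda>x. cmod (f x * g x)) summable_on A" using cs(1) by (simp add: norm_mult)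
  thus "(\<lambda>x. f x * g x) summable_on A" by (rule abs_summable_summable)
  show 2: "(\<Sum>\<^sub>\<infinity>x\<in>A. cmod (f x * g x)) \<le> sqrt (\<Sum>\<^sub>\<infinity>x\<in>A. (cmod (f x))\<^sup>2) * sqrt (\<Sum>\<^sub>\<infinity>x\<in>A. (cmod (g x))\<^sup>2)"
    using cs(2) by (simp add: norm_mult)
  show "cmod (\<Sum>\<^sub>\<infinity>x\<in>A. f x * g x) \<le> sqrt (\<Sum>\<^sub>\<infinity>x\<in>A. (cmod (f x))\<^sup>2) * sqrt (\<Sum>\<^sub>\<infinity>x\<in>A. (cmod (g x))\<^sup>2)"
    using norm_infsum_bound[OF 1] 2 by linarith
qed

lemma summable_on_square_add:
  fixes f g :: "'a \<Rightarrow> complex"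
  assumes f: "(\<lambda>x. (cmod (f x))\<^sup>2) summable_on A" and g: "(\<lambda>x. (cmod (g x))\<^sup>2) summable_on A"
  shows "(\<lambda>x. (cmod (f x + g x))\<^sup>2) summable_on A"
proof (rule summable_on_comparison_test)
  show "(\<lambda>x. 2 * (cmod (f x))\<^sup>2 + 2 * (cmod (g x))\<^sup>2) summable_on A"
    using f g by (intro summable_on_add summable_on_cmult_right)
  fix x
  have "(cmod (f x + g x))\<^sup>2 \<le> (cmod (f x) + cmod (g x))\<^sup>2"
    by (intro power_mono norm_triangle_ineq) auto
  also have "\<dots> \<le> 2 * (cmod (f x))\<^sup>2 + 2 * (cmod (g x))\<^sup>2"
    using sum_squares_bound[of "cmod (f x)" "cmod (g x)"] by (simp add: power2_sum)
  finally show "(cmod (f x + g x))\<^sup>2 \<le> 2 * (cmod (f x))\<^sup>2 + 2 * (cmod (g x))\<^sup>2" .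
qed auto

text \<open>The operator \<open>I + H\<close> is inverted by the Neumann series. Let \<open>q < 1\<close> be the Hilbert-Schmidt norm
  of \<open>H\<close> and \<open>h(x)\<close> the \<open>\<ell>\<^sup>2\<close> norm of its row \<open>x\<close>. The Cauchy-Schwarz inequality bounds the term
  \<open>(-H)\<^bsup>n+1\<^esup> a\<close> at \<open>x\<close> by \<open>h(x) q\<^sup>n \<parallel>a\<parallel>\<close>. Because \<open>h\<close> is itself in \<open>\<ell>\<^sup>2\<close>, the series can be summed
  pointwise, and the sum is automatically in \<open>\<ell>\<^sup>2\<close>.\<close>

lemma hilbert_schmidt_neumann:
  fixes H :: "'a \<Rightarrow> 'a \<Rightarrow> complex" and a :: "'a \<Rightarrow> complex"
  assumes H: "(\<lambda>(x, y). (cmod (H x y))\<^sup>2) summable_on L \<times> L"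
    and small: "(\<Sum>\<^sub>\<infinity>(x, y)\<in>L \<times> L. (cmod (H x y))\<^sup>2) < 1"
    and a: "(\<lambda>x. (cmod (a x))\<^sup>2) summable_on L"
  obtains c where "(\<lambda>x. (cmod (c x))\<^sup>2) summable_on L"
    and "\<And>x. x \<in> L \<Longrightarrow> c x + (\<Sum>\<^sub>\<infinity>y\<in>L. H x y * c y) = a x"
proof -
  define q where "q = sqrt (\<Sum>\<^sub>\<infinity>(x, y)\<in>L \<times> L. (cmod (H x y))\<^sup>2)"
  define h where "h = (\<lambda>x. sqrt (\<Sum>\<^sub>\<infinity>y\<in>L. (cmod (H x y))\<^sup>2))"
  define N where "N = sqrt (\<Sum>\<^sub>\<infinity>x\<in>L. (cmod (a x))\<^sup>2)"
  define u where "u = rec_nat a (\<lambda>_ v x. - (\<Sum>\<^sub>\<infinity>y\<in>L. H x y * v y))"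
  have u_0: "u 0 = a" and u_Suc: "u (Suc n) x = - (\<Sum>\<^sub>\<infinity>y\<in>L. H x y * u n y)" for n x
    by (simp_all add: u_def)
  have q: "0 \<le> q" "q < 1"
    using small by (auto simp: q_def intro!: infsum_nonneg)
  have N: "0 \<le> N" by (simp add: N_def infsum_nonneg)
  have h_nonneg: "0 \<le> h x" for x by (simp add: h_def infsum_nonneg)
  have row: "(\<lambda>y. (cmod (H x y))\<^sup>2) summable_on L" if "x \<in> L" for x
    using summable_on_SigmaD1[of "\<lambda>x y. (cmod (H x y))\<^sup>2" L "\<lambda>_. L" x] H that by simp
  have h_sq: "(h x)\<^sup>2 = (\<Sum>\<^sub>\<infinity>y\<in>L. (cmod (H x y))\<^sup>2)" for x
    by (simp add: h_def infsum_nonneg)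
  have h_summable: "(\<lambda>x. (h x)\<^sup>2) summable_on L"
    unfolding h_sq using summable_on_Sigma_banach[OF H] by simp
  have h_sum: "(\<Sum>\<^sub>\<infinity>x\<in>L. (h x)\<^sup>2) = q\<^sup>2"
    unfolding h_sq q_def using infsum_Sigma'_banach[OF H] by (simp add: infsum_nonneg case_prod_beta)
  \<comment> \<open>Cauchy-Schwarz along a row, for vectors whose norm is at most that of the n-th Neumann term\<close>
  have apply_bound: "(\<lambda>y. cmod (H x y * v y)) summable_on L"
      "(\<Sum>\<^sub>\<infinity>y\<in>L. cmod (H x y * v y)) \<le> h x * (q ^ n * N)"
      "cmod (\<Sum>\<^sub>\<infinity>y\<in>L. H x y * v y) \<le> h x * (q ^ n * N)"
    if x: "x \<in> L" and v: "(\<lambda>x. (cmod (v x))\<^sup>2) summable_on L"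
      "(\<Sum>\<^sub>\<infinity>x\<in>L. (cmod (v x))\<^sup>2) \<le> (q ^ n * N)\<^sup>2" for x v n
  proof -
    note cs = cauchy_schwarz_infsum_complex[OF row[OF x] v(1)]
    show 1: "(\<lambda>y. cmod (H x y * v y)) summable_on L" by (rule cs)
    have "sqrt (\<Sum>\<^sub>\<infinity>x\<in>L. (cmod (v x))\<^sup>2) \<le> q ^ n * N"
      using v(2) q N by (intro real_le_lsqrt) (auto intro: infsum_nonneg)
    hence "h x * sqrt (\<Sum>\<^sub>\<infinity>x\<in>L. (cmod (v x))\<^sup>2) \<le> h x * (q ^ n * N)"
      by (intro mult_left_mono h_nonneg)
    with cs(3,4) show "(\<Sum>\<^sub>\<infinity>y\<in>L. cmod (H x y * v y)) \<le> h x * (q ^ n * N)"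
      "cmod (\<Sum>\<^sub>\<infinity>y\<in>L. H x y * v y) \<le> h x * (q ^ n * N)" unfolding h_def by linarith+
  qed
  have u_bound: "(\<lambda>x. (cmod (u n x))\<^sup>2) summable_on L \<and> (\<Sum>\<^sub>\<infinity>x\<in>L. (cmod (u n x))\<^sup>2) \<le> (q ^ n * N)\<^sup>2" for n
  proof (induction n)
    case 0
    show ?case using a by (simp add: u_0 N_def infsum_nonneg)
  next
    case (Suc n)
    have le: "(cmod (u (Suc n) x))\<^sup>2 \<le> (q ^ n * N)\<^sup>2 * (h x)\<^sup>2" if "x \<in> L" for x
      using power_mono[OF apply_bound(3)[OF that conjunct1[OF Suc] conjunct2[OF Suc]], of 2]
      by (simp add: u_Suc power_mult_distrib mult_ac)
    have sm: "(\<lambda>x. (q ^ n * N)\<^sup>2 * (h x)\<^sup>2) summable_on L"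
      by (intro summable_on_cmult_right h_summable)
    have sm': "(\<lambda>x. (cmod (u (Suc n) x))\<^sup>2) summable_on L"
      by (rule summable_on_comparison_test[OF sm le]) auto
    have "(\<Sum>\<^sub>\<infinity>x\<in>L. (cmod (u (Suc n) x))\<^sup>2) \<le> (\<Sum>\<^sub>\<infinity>x\<in>L. (q ^ n * N)\<^sup>2 * (h x)\<^sup>2)"
      by (rule infsum_mono[OF sm' sm le])
    also have "\<dots> = (q ^ Suc n * N)\<^sup>2"
      by (subst infsum_cmult_right') (simp add: h_sum power_mult_distrib)
    finally show ?case using sm' by blast
  qed
  have u_Suc_le: "cmod (u (Suc n) x) \<le> h x * (q ^ n * N)" if "x \<in> L" for n x
    unfolding u_Suc norm_minus_cancel using u_bound that by (intro apply_bound) auto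
  have geo: "(\<lambda>n. h x * (q ^ n * N)) summable_on UNIV" for x
    using q N h_nonneg by (intro summable_nonneg_imp_summable_on summable_mult summable_mult2 summable_geometric) auto
  have geo_sum: "(\<Sum>\<^sub>\<infinity>n. h x * (q ^ n * N)) = h x * (N / (1 - q))" for x
  proof -
    have "(\<lambda>n. h x * (q ^ n * N)) sums (h x * (1 / (1 - q) * N))"
      using q by (intro sums_mult sums_mult2 geometric_sums) auto
    thus ?thesis using q N h_nonneg
      by (intro infsumI sums_nonneg_imp_has_sum) auto
  qed
  have uS: "(\<lambda>n. cmod (u (Suc n) x)) summable_on UNIV" if "x \<in> L" for x
    by (rule summable_on_comparison_test[OF geo u_Suc_le[OF that]]) auto
  define d where "d = (\<lambda>x. \<Sum>\<^sub>\<infinity>n. u (Suc n) x)"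
  define c where "c = (\<lambda>x. a x + d x)"
  have d_le: "cmod (d x) \<le> h x * (N / (1 - q))" if "x \<in> L" for x
  proof -
    have "cmod (d x) \<le> (\<Sum>\<^sub>\<infinity>n. cmod (u (Suc n) x))"
      unfolding d_def by (rule norm_infsum_bound[OF uS[OF that]])
    also have "\<dots> \<le> (\<Sum>\<^sub>\<infinity>n. h x * (q ^ n * N))"
      by (rule infsum_mono[OF uS[OF that] geo u_Suc_le[OF that]])
    finally show ?thesis by (simp add: geo_sum)
  qed
  have "(\<lambda>x. (cmod (d x))\<^sup>2) summable_on L"
  proof (rule summable_on_comparison_test)
    show "(\<lambda>x. (N / (1 - q))\<^sup>2 * (h x)\<^sup>2) summable_on L"
      by (intro summable_on_cmult_right h_summable)
    show "(cmod (d x))\<^sup>2 \<le> (N / (1 - q))\<^sup>2 * (h x)\<^sup>2" if "x \<in> L" for x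
      using power_mono[OF d_le[OF that], of 2] by (simp add: power_mult_distrib power_divide mult_ac)
  qed auto
  hence c: "(\<lambda>x. (cmod (c x))\<^sup>2) summable_on L"
    unfolding c_def by (rule summable_on_square_add[OF a])
  have c_eq: "((\<lambda>n. u n x) has_sum c x) UNIV" if x: "x \<in> L" for x
  proof -
    have "((\<lambda>n. u (Suc n) x) has_sum d x) UNIV"
      unfolding d_def by (rule has_sum_infsum, rule abs_summable_summable, rule uS[OF x])
    hence "((\<lambda>n. u n x) has_sum d x) (range Suc)"
      by (subst has_sum_reindex) (auto simp: o_def)
    hence "((\<lambda>n. u n x) has_sum u 0 x + d x) (insert 0 (range Suc))"
      by (intro has_sum_insert) auto
    moreover have "insert 0 (range Suc) = UNIV" by (metis UNIV_nat_eq)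
    ultimately show ?thesis by (simp add: c_def u_0)
  qed
  have "c x + (\<Sum>\<^sub>\<infinity>y\<in>L. H x y * c y) = a x" if x: "x \<in> L" for x
  proof -
    have un: "(\<lambda>y. cmod (H x y * u n y)) summable_on L"
        "(\<Sum>\<^sub>\<infinity>y\<in>L. cmod (H x y * u n y)) \<le> h x * (q ^ n * N)" for n
      using apply_bound[OF x] u_bound by blast+
    have "(\<lambda>n. \<Sum>\<^sub>\<infinity>y\<in>L. cmod (H x y * u n y)) summable_on UNIV"
      by (rule summable_on_comparison_test[OF geo un(2)]) (auto intro: infsum_nonneg)
    hence "(\<lambda>p. norm ((\<lambda>(n, y). H x y * u n y) p)) summable_on UNIV \<times> L"
      using un(1) by (subst Infinite_Sum.abs_summable_on_Sigma_iff) (simp add: infsum_nonneg)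
    hence dbl: "(\<lambda>(n, y). H x y * u n y) summable_on UNIV \<times> L"
      by (rule abs_summable_summable)
    have "(\<Sum>\<^sub>\<infinity>y\<in>L. H x y * c y) = (\<Sum>\<^sub>\<infinity>y\<in>L. \<Sum>\<^sub>\<infinity>n. H x y * u n y)"
      using c_eq by (intro infsum_cong) (simp add: infsum_cmult_right' infsumI[OF c_eq])
    also have "\<dots> = (\<Sum>\<^sub>\<infinity>n. \<Sum>\<^sub>\<infinity>y\<in>L. H x y * u n y)"
      by (rule infsum_swap_banach[OF dbl, symmetric])
    also have "\<dots> = (\<Sum>\<^sub>\<infinity>n. - u (Suc n) x)" by (simp add: u_Suc)
    also have "\<dots> = - d x" by (simp add: infsum_uminus d_def)
    finally show ?thesis by (simp add: c_def)
  qed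
  with c that show thesis by blast
qed

section \<open>Almost orthonormal systems\<close>

lemma has_sum_finite_sum:
  fixes f :: "'b \<Rightarrow> 'a \<Rightarrow> 'c::topological_comm_monoid_add"
  assumes "finite S" "\<And>s. s \<in> S \<Longrightarrow> (f s has_sum g s) A"
  shows "((\<lambda>x. \<Sum>s\<in>S. f s x) has_sum (\<Sum>s\<in>S. g s)) A"
  using assms by (induction S rule: finite_induct) (auto intro!: has_sum_add)

text \<open>Closes the duality arguments below, where the Cauchy-Schwarz bound for a square sum contains the
  square root of the same sum, which is then divided out.\<close>

lemma le_double_if_le_sqrt:
  fixes T A :: real
  assumes "T \<le> sqrt A * sqrt (2 * T)" "0 \<le> T" "0 \<le> A"
  shows "T \<le> 2 * A"
proof (cases "T = 0")
  case False
  have "T\<^sup>2 \<le> (sqrt (A * (2 * T)))\<^sup>2"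
    using assms by (intro power_mono) (auto simp: real_sqrt_mult)
  also have "\<dots> = A * (2 * T)" using assms by simp
  finally have "T * T \<le> (2 * A) * T" by (simp add: power2_eq_square mult_ac)
  thus ?thesis using assms False by (simp add: mult_le_cancel_right)
qed (use assms in auto)

text \<open>The abstract form of the normalised kernels: unit vectors given by their coordinates, whose Gram matrix differs from the identity by a
  matrix of Hilbert-Schmidt norm less than 1. The square-summable majorant \<open>w\<close> and the absolute
  summability of each \<open>e x\<close> make the double sums over points and coordinates converge absolutely;
  normalised kernels have both properties, with \<open>w x = 1 / \<parallel>k\<^sub>x\<parallel>\<close>.\<close>

locale almost_orthonormal =
  fixes L :: "'a set" and e :: "'a \<Rightarrow> 'i \<Rightarrow> complex" and w :: "'a \<Rightarrow> real"
  assumes w_summable: "(\<lambda>x. (w x)\<^sup>2) summable_on L"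
    and e_le: "\<And>x i. x \<in> L \<Longrightarrow> cmod (e x i) \<le> w x"
    and e_summable: "\<And>x. x \<in> L \<Longrightarrow> (\<lambda>i. cmod (e x i)) summable_on UNIV"
    and e_unit: "\<And>x. x \<in> L \<Longrightarrow> (\<Sum>\<^sub>\<infinity>i. (cmod (e x i))\<^sup>2) = 1"
    and gram_summable: "(\<lambda>(x, y). (cmod (if x = y then 0 else \<Sum>\<^sub>\<infinity>i. e x i * cnj (e y i)))\<^sup>2) summable_on L \<times> L"
    and gram_small: "(\<Sum>\<^sub>\<infinity>(x, y)\<in>L \<times> L. (cmod (if x = y then 0 else \<Sum>\<^sub>\<infinity>i. e x i * cnj (e y i)))\<^sup>2) < 1"
begin

definition gram_defect :: "'a \<Rightarrow> 'a \<Rightarrow> complex" where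
  "gram_defect x y = (if x = y then 0 else \<Sum>\<^sub>\<infinity>i. e x i * cnj (e y i))"

lemma gram_defect_summable: "(\<lambda>(x, y). (cmod (gram_defect x y))\<^sup>2) summable_on L \<times> L"
  using gram_summable unfolding gram_defect_def .

lemma gram_defect_small: "(\<Sum>\<^sub>\<infinity>(x, y)\<in>L \<times> L. (cmod (gram_defect x y))\<^sup>2) < 1"
  using gram_small unfolding gram_defect_def .

lemma e_sq_summable: "x \<in> L \<Longrightarrow> (\<lambda>i. (cmod (e x i))\<^sup>2) summable_on UNIV"
  by (rule summable_on_comparison_test[OF summable_on_cmult_right[OF e_summable, of _ "w x"]])
     (auto simp: power2_eq_square intro!: mult_right_mono e_le)

lemma gram_has_sum:
  assumes "x \<in> L" "y \<in> L"
  shows "((\<lambda>i. e x i * cnj (e y i)) has_sum (if x = y then 1 else 0) + gram_defect x y) UNIV"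
proof (cases "x = y")
  case True
  have "((\<lambda>i. (cmod (e x i))\<^sup>2) has_sum 1) UNIV"
    using e_sq_summable e_unit assms by (metis has_sum_infsum)
  hence "((\<lambda>i. complex_of_real ((cmod (e x i))\<^sup>2)) has_sum of_real 1) UNIV"
    by (rule has_sum_of_real)
  thus ?thesis using True unfolding complex_norm_square by (simp add: gram_defect_def)
next
  case False
  have "(\<lambda>i. e x i * cnj (e y i)) summable_on UNIV"
    using assms by (intro cauchy_schwarz_infsum_complex) (auto intro: e_sq_summable)
  thus ?thesis using False by (simp add: gram_defect_def)
qed

text \<open>The norm of a finite combination of the vectors is a quadratic form in the Gram matrix. The
  identity contributes \<open>\<Sum>|c x|\<^sup>2\<close>, and the rest at most as much, by the Cauchy-Schwarz inequality
  over pairs of points.\<close>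

lemma gram_form_bound:
  assumes S: "finite S" "S \<subseteq> L"
  shows "(\<lambda>i. (cmod (\<Sum>x\<in>S. c x * e x i))\<^sup>2) summable_on UNIV"
    and "(\<Sum>\<^sub>\<infinity>i. (cmod (\<Sum>x\<in>S. c x * e x i))\<^sup>2) \<le> 2 * (\<Sum>x\<in>S. (cmod (c x))\<^sup>2)"
proof -
  define T where "T = (\<Sum>x\<in>S. (cmod (c x))\<^sup>2)"
  define G where "G = (\<Sum>x\<in>S. \<Sum>y\<in>S. c x * cnj (c y) * ((if x = y then 1 else 0) + gram_defect x y))"
  have "((\<lambda>i. \<Sum>x\<in>S. \<Sum>y\<in>S. c x * cnj (c y) * (e x i * cnj (e y i))) has_sum G) UNIV"
    unfolding G_def using S
    by (intro has_sum_finite_sum has_sum_cmult_right gram_has_sum) auto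
  also have "(\<lambda>i. \<Sum>x\<in>S. \<Sum>y\<in>S. c x * cnj (c y) * (e x i * cnj (e y i)))
      = (\<lambda>i. complex_of_real ((cmod (\<Sum>x\<in>S. c x * e x i))\<^sup>2))"
    unfolding complex_norm_square cnj_sum sum_product by (simp add: mult_ac)
  finally have sum: "((\<lambda>i. complex_of_real ((cmod (\<Sum>x\<in>S. c x * e x i))\<^sup>2)) has_sum G) UNIV" .
  from has_sum_Re[OF this] have re: "((\<lambda>i. (cmod (\<Sum>x\<in>S. c x * e x i))\<^sup>2) has_sum Re G) UNIV"
    by simp
  thus "(\<lambda>i. (cmod (\<Sum>x\<in>S. c x * e x i))\<^sup>2) summable_on UNIV"
    by (rule has_sum_imp_summable)
  have "G = (\<Sum>x\<in>S. c x * cnj (c x)) + (\<Sum>x\<in>S. \<Sum>y\<in>S. c x * cnj (c y) * gram_defect x y)"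
  proof -
    have "c x * cnj (c y) * ((if x = y then 1 else 0) + gram_defect x y)
        = (if x = y then c x * cnj (c x) else 0) + c x * cnj (c y) * gram_defect x y" for x y
      by (simp add: algebra_simps)
    thus ?thesis using S(1) by (simp add: G_def sum.distrib)
  qed
  also have "(\<Sum>x\<in>S. c x * cnj (c x)) = of_real T"
    by (simp add: T_def complex_norm_square del: of_real_power)
  finally have G: "G = of_real T + (\<Sum>x\<in>S. \<Sum>y\<in>S. c x * cnj (c y) * gram_defect x y)" .
  have "cmod (\<Sum>x\<in>S. \<Sum>y\<in>S. c x * cnj (c y) * gram_defect x y)
      \<le> (\<Sum>p\<in>S \<times> S. (cmod (c (fst p)) * cmod (c (snd p))) * cmod (gram_defect (fst p) (snd p)))"
    unfolding sum.cartesian_product case_prod_beta by (rule order_trans[OF norm_sum]) (simp add: norm_mult)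
  also have "\<dots> \<le> L2_set (\<lambda>p. cmod (c (fst p)) * cmod (c (snd p))) (S \<times> S) * L2_set (\<lambda>p. cmod (gram_defect (fst p) (snd p))) (S \<times> S)"
    using L2_set_mult_ineq[of "\<lambda>p. cmod (c (fst p)) * cmod (c (snd p))" "\<lambda>p. cmod (gram_defect (fst p) (snd p))" "S \<times> S"] by simp
  also have "L2_set (\<lambda>p. cmod (c (fst p)) * cmod (c (snd p))) (S \<times> S) = T"
  proof -
    have "(\<Sum>p\<in>S \<times> S. (cmod (c (fst p)) * cmod (c (snd p)))\<^sup>2) = T\<^sup>2"
      unfolding T_def power2_eq_square[of "sum _ _"] sum_product sum.cartesian_product
      by (simp add: power_mult_distrib case_prod_beta)
    moreover have "0 \<le> T" by (simp add: T_def sum_nonneg)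
    ultimately show ?thesis by (simp add: L2_set_def)
  qed
  also have "T * L2_set (\<lambda>p. cmod (gram_defect (fst p) (snd p))) (S \<times> S) \<le> T * 1"
  proof (rule mult_left_mono)
    have "(\<Sum>p\<in>S \<times> S. (cmod (gram_defect (fst p) (snd p)))\<^sup>2) \<le> (\<Sum>\<^sub>\<infinity>(x, y)\<in>L \<times> L. (cmod (gram_defect x y))\<^sup>2)"
      using S gram_defect_summable unfolding case_prod_beta by (intro finite_sum_le_infsum) auto
    with gram_defect_small show "L2_set (\<lambda>p. cmod (gram_defect (fst p) (snd p))) (S \<times> S) \<le> 1" by (simp add: L2_set_def)
  qed (simp add: T_def sum_nonneg)
  finally have "cmod (\<Sum>x\<in>S. \<Sum>y\<in>S. c x * cnj (c y) * gram_defect x y) \<le> T"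
    by simp
  hence "Re G \<le> 2 * T"
    unfolding G using complex_Re_le_cmod[of "\<Sum>x\<in>S. \<Sum>y\<in>S. c x * cnj (c y) * gram_defect x y"] by simp
  thus "(\<Sum>\<^sub>\<infinity>i. (cmod (\<Sum>x\<in>S. c x * e x i))\<^sup>2) \<le> 2 * (\<Sum>x\<in>S. (cmod (c x))\<^sup>2)"
    using infsumI[OF re] by (simp add: T_def)
qed

text \<open>Dual to \<open>gram_form_bound\<close>: if \<open>c x\<close> denotes the pairing of \<open>\<alpha>\<close> with \<open>e x\<close>, then a finite sum of
  \<open>|c x|\<^sup>2\<close> is the pairing of \<open>\<alpha>\<close> with the combination \<open>\<Sum>\<^sub>x cnj (c x) e x\<close>.\<close>

lemma bessel_inequality:
  assumes \<alpha>: "(\<lambda>i. (cmod (\<alpha> i))\<^sup>2) summable_on UNIV"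
  shows "(\<lambda>x. (cmod (\<Sum>\<^sub>\<infinity>i. \<alpha> i * e x i))\<^sup>2) summable_on L"
    and "(\<Sum>\<^sub>\<infinity>x\<in>L. (cmod (\<Sum>\<^sub>\<infinity>i. \<alpha> i * e x i))\<^sup>2) \<le> 2 * (\<Sum>\<^sub>\<infinity>i. (cmod (\<alpha> i))\<^sup>2)"
proof -
  define A where "A = (\<Sum>\<^sub>\<infinity>i. (cmod (\<alpha> i))\<^sup>2)"
  define c where "c = (\<lambda>x. \<Sum>\<^sub>\<infinity>i. \<alpha> i * e x i)"
  have le: "(\<Sum>x\<in>S. (cmod (c x))\<^sup>2) \<le> 2 * A" if S: "finite S" "S \<subseteq> L" for S
  proof -
    define T where "T = (\<Sum>x\<in>S. (cmod (c x))\<^sup>2)"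
    define \<beta> where "\<beta> = (\<lambda>i. \<Sum>x\<in>S. cnj (c x) * e x i)"
    have \<beta>: "(\<lambda>i. (cmod (\<beta> i))\<^sup>2) summable_on UNIV" "(\<Sum>\<^sub>\<infinity>i. (cmod (\<beta> i))\<^sup>2) \<le> 2 * T"
      using gram_form_bound[OF S, of "\<lambda>x. cnj (c x)"] by (simp_all add: \<beta>_def T_def)
    have "((\<lambda>i. \<Sum>x\<in>S. cnj (c x) * (\<alpha> i * e x i)) has_sum (\<Sum>x\<in>S. cnj (c x) * c x)) UNIV"
    proof (intro has_sum_finite_sum has_sum_cmult_right S)
      fix x assume "x \<in> S"
      hence "(\<lambda>i. \<alpha> i * e x i) summable_on UNIV"
        using S by (intro cauchy_schwarz_infsum_complex \<alpha> e_sq_summable) auto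
      thus "((\<lambda>i. \<alpha> i * e x i) has_sum c x) UNIV" by (simp add: c_def)
    qed
    also have "(\<lambda>i. \<Sum>x\<in>S. cnj (c x) * (\<alpha> i * e x i)) = (\<lambda>i. \<alpha> i * \<beta> i)"
      by (simp add: \<beta>_def sum_distrib_left mult_ac)
    also have "(\<Sum>x\<in>S. cnj (c x) * c x) = of_real T"
      by (simp add: T_def complex_norm_square mult.commute del: of_real_power)
    finally have T: "complex_of_real T = (\<Sum>\<^sub>\<infinity>i. \<alpha> i * \<beta> i)" by (simp add: infsumI)
    have "0 \<le> T" by (simp add: T_def sum_nonneg)
    hence "T = cmod (complex_of_real T)" by simp
    also have "\<dots> = cmod (\<Sum>\<^sub>\<infinity>i. \<alpha> i * \<beta> i)"
      unfolding T ..
    also have "\<dots> \<le> sqrt A * sqrt (\<Sum>\<^sub>\<infinity>i. (cmod (\<beta> i))\<^sup>2)"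
      unfolding A_def by (rule cauchy_schwarz_infsum_complex[OF \<alpha> \<beta>(1)])
    also have "\<dots> \<le> sqrt A * sqrt (2 * T)"
      using \<beta>(2) by (intro mult_left_mono real_sqrt_le_mono) (auto simp: A_def infsum_nonneg)
    finally show ?thesis
      unfolding T_def[symmetric] by (rule le_double_if_le_sqrt) (auto simp: T_def A_def sum_nonneg infsum_nonneg)
  qed
  show sm: "(\<lambda>x. (cmod (\<Sum>\<^sub>\<infinity>i. \<alpha> i * e x i))\<^sup>2) summable_on L"
    using le unfolding c_def by (intro nonneg_bdd_above_summable_on bdd_aboveI2) auto
  show "(\<Sum>\<^sub>\<infinity>x\<in>L. (cmod (\<Sum>\<^sub>\<infinity>i. \<alpha> i * e x i))\<^sup>2) \<le> 2 * (\<Sum>\<^sub>\<infinity>i. (cmod (\<alpha> i))\<^sup>2)"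
    using infsum_le_finite_sums[OF sm] le unfolding c_def A_def by blast
qed

text \<open>The solution is \<open>\<alpha> = \<Sum>\<^sub>y c(y) cnj (e y)\<close>, where \<open>c\<close> solves the system with the Gram matrix and
  right-hand side \<open>a\<close>. That \<open>\<alpha>\<close> is square summable follows from the Bessel inequality applied to
  its finite truncations.\<close>

lemma moment_problem_solvable:
  assumes a: "(\<lambda>x. (cmod (a x))\<^sup>2) summable_on L"
  obtains \<alpha> where "(\<lambda>i. (cmod (\<alpha> i))\<^sup>2) summable_on UNIV"
    and "\<And>x. x \<in> L \<Longrightarrow> (\<Sum>\<^sub>\<infinity>i. \<alpha> i * e x i) = a x"
proof -
  obtain c where c: "(\<lambda>x. (cmod (c x))\<^sup>2) summable_on L"
    and c_eq: "\<And>x. x \<in> L \<Longrightarrow> c x + (\<Sum>\<^sub>\<infinity>y\<in>L. gram_defect x y * c y) = a x"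
    using hilbert_schmidt_neumann[OF gram_defect_summable gram_defect_small a] by metis
  define C where "C = (\<Sum>\<^sub>\<infinity>y\<in>L. (cmod (c y))\<^sup>2)"
  have cw: "(\<lambda>y. cmod (c y) * \<bar>w y\<bar>) summable_on L"
    using c w_summable by (intro cauchy_schwarz_infsum) auto
  have ce: "(\<lambda>y. cmod (c y * cnj (e y i))) summable_on L" for i
    by (rule summable_on_comparison_test[OF cw])
       (auto simp: norm_mult intro!: mult_left_mono order_trans[OF e_le])
  define \<alpha> where "\<alpha> = (\<lambda>i. \<Sum>\<^sub>\<infinity>y\<in>L. c y * cnj (e y i))"
  have "(\<lambda>i. (cmod (\<alpha> i))\<^sup>2) summable_on UNIV"
  proof (intro nonneg_bdd_above_summable_on bdd_aboveI2)
    fix I :: "'i set" assume "I \<in> {F. F \<subseteq> UNIV \<and> finite F}"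
    hence I: "finite I" by simp
    define T where "T = (\<Sum>i\<in>I. (cmod (\<alpha> i))\<^sup>2)"
    \<comment> \<open>Pairing \<open>c\<close> with the coefficients of the truncation of \<open>\<alpha>\<close> to \<open>I\<close> recovers its squared norm.\<close>
    define \<beta> where "\<beta> = (\<lambda>i. if i \<in> I then \<alpha> i else 0)"
    define \<gamma> where "\<gamma> = (\<lambda>y. \<Sum>\<^sub>\<infinity>i. \<beta> i * e y i)"
    have \<beta>_sum: "((\<lambda>i. (cmod (\<beta> i))\<^sup>2) has_sum T) UNIV"
      by (rule has_sum_finite_neutralI[of I]) (use I in \<open>auto simp: \<beta>_def T_def\<close>)
    have \<gamma>_eq: "\<gamma> y = (\<Sum>i\<in>I. \<alpha> i * e y i)" for y
      unfolding \<gamma>_def by (rule infsumI, rule has_sum_finite_neutralI[of I]) (use I in \<open>auto simp: \<beta>_def\<close>)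
    have \<gamma>: "(\<lambda>y. (cmod (\<gamma> y))\<^sup>2) summable_on L" "(\<Sum>\<^sub>\<infinity>y\<in>L. (cmod (\<gamma> y))\<^sup>2) \<le> 2 * T"
      using bessel_inequality[OF has_sum_imp_summable[OF \<beta>_sum]] infsumI[OF \<beta>_sum] by (simp_all add: \<gamma>_def)
    hence \<gamma>': "(\<lambda>y. (cmod (cnj (\<gamma> y)))\<^sup>2) summable_on L" by simp
    have "((\<lambda>y. \<Sum>i\<in>I. cnj (\<alpha> i) * (c y * cnj (e y i))) has_sum (\<Sum>i\<in>I. cnj (\<alpha> i) * \<alpha> i)) L"
      unfolding \<alpha>_def by (intro has_sum_finite_sum has_sum_cmult_right I has_sum_infsum abs_summable_summable[OF ce])
    also have "(\<lambda>y. \<Sum>i\<in>I. cnj (\<alpha> i) * (c y * cnj (e y i))) = (\<lambda>y. c y * cnj (\<gamma> y))"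
      by (simp add: \<gamma>_eq sum_distrib_left mult_ac)
    also have "(\<Sum>i\<in>I. cnj (\<alpha> i) * \<alpha> i) = of_real T"
      by (simp add: T_def complex_norm_square mult.commute del: of_real_power)
    finally have T: "complex_of_real T = (\<Sum>\<^sub>\<infinity>y\<in>L. c y * cnj (\<gamma> y))" by (simp add: infsumI)
    have "0 \<le> T" by (simp add: T_def sum_nonneg)
    hence "T = cmod (complex_of_real T)" by simp
    also have "\<dots> = cmod (\<Sum>\<^sub>\<infinity>y\<in>L. c y * cnj (\<gamma> y))"
      unfolding T ..
    also have "\<dots> \<le> sqrt C * sqrt (\<Sum>\<^sub>\<infinity>y\<in>L. (cmod (cnj (\<gamma> y)))\<^sup>2)"
      unfolding C_def by (rule cauchy_schwarz_infsum_complex[OF c \<gamma>'])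
    also have "\<dots> \<le> sqrt C * sqrt (2 * T)"
      using \<gamma>(2) by (intro mult_left_mono real_sqrt_le_mono) (auto simp: C_def infsum_nonneg)
    finally show "(\<Sum>i\<in>I. (cmod (\<alpha> i))\<^sup>2) \<le> 2 * C"
      unfolding T_def[symmetric] by (rule le_double_if_le_sqrt) (auto simp: T_def C_def sum_nonneg infsum_nonneg)
  qed auto
  moreover have "(\<Sum>\<^sub>\<infinity>i. \<alpha> i * e x i) = a x" if x: "x \<in> L" for x
  proof -
    \<comment> \<open>Absolute convergence allows summing over coordinates first, which produces the Gram matrix.\<close>
    have "(\<lambda>p. norm ((\<lambda>(i, y). c y * cnj (e y i) * e x i) p)) summable_on UNIV \<times> L"
    proof (subst Infinite_Sum.abs_summable_on_Sigma_iff, intro conjI ballI)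
      show "(\<lambda>y. norm ((\<lambda>(i, y). c y * cnj (e y i) * e x i) (i, y))) summable_on L" for i
        using summable_on_cmult_left[OF ce[of i], of "cmod (e x i)"] by (simp add: norm_mult)
      show "(\<lambda>i. norm (\<Sum>\<^sub>\<infinity>y\<in>L. norm ((\<lambda>(i, y). c y * cnj (e y i) * e x i) (i, y)))) summable_on UNIV"
      proof (rule summable_on_comparison_test)
        show "(\<lambda>i. (\<Sum>\<^sub>\<infinity>y\<in>L. cmod (c y) * \<bar>w y\<bar>) * cmod (e x i)) summable_on UNIV"
          by (intro summable_on_cmult_right e_summable x)
        fix i
        have "(\<Sum>\<^sub>\<infinity>y\<in>L. cmod (c y * cnj (e y i))) \<le> (\<Sum>\<^sub>\<infinity>y\<in>L. cmod (c y) * \<bar>w y\<bar>)"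
          by (rule infsum_mono[OF ce cw])
             (auto simp: norm_mult intro!: mult_left_mono order_trans[OF e_le])
        hence "(\<Sum>\<^sub>\<infinity>y\<in>L. cmod (c y * cnj (e y i))) * cmod (e x i) \<le> (\<Sum>\<^sub>\<infinity>y\<in>L. cmod (c y) * \<bar>w y\<bar>) * cmod (e x i)"
          by (rule mult_right_mono) simp
        thus "norm (\<Sum>\<^sub>\<infinity>y\<in>L. norm ((\<lambda>(i, y). c y * cnj (e y i) * e x i) (i, y)))
            \<le> (\<Sum>\<^sub>\<infinity>y\<in>L. cmod (c y) * \<bar>w y\<bar>) * cmod (e x i)"
          by (simp add: norm_mult infsum_cmult_left' infsum_nonneg abs_mult)
      qed auto
    qed
    hence dbl: "(\<lambda>(i, y). c y * cnj (e y i) * e x i) summable_on UNIV \<times> L"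
      by (rule abs_summable_summable)
    have "(\<Sum>\<^sub>\<infinity>i. \<alpha> i * e x i) = (\<Sum>\<^sub>\<infinity>i. \<Sum>\<^sub>\<infinity>y\<in>L. c y * cnj (e y i) * e x i)"
      by (simp add: \<alpha>_def infsum_cmult_left')
    also have "\<dots> = (\<Sum>\<^sub>\<infinity>y\<in>L. \<Sum>\<^sub>\<infinity>i. c y * cnj (e y i) * e x i)"
      by (rule infsum_swap_banach[OF dbl])
    also have "\<dots> = (\<Sum>\<^sub>\<infinity>y\<in>L. c y * ((if x = y then 1 else 0) + gram_defect x y))"
    proof (rule infsum_cong)
      fix y assume "y \<in> L"
      have "((\<lambda>i. c y * (e x i * cnj (e y i))) has_sum c y * ((if x = y then 1 else 0) + gram_defect x y)) UNIV"
        by (intro has_sum_cmult_right gram_has_sum x \<open>y \<in> L\<close>)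
      thus "(\<Sum>\<^sub>\<infinity>i. c y * cnj (e y i) * e x i) = c y * ((if x = y then 1 else 0) + gram_defect x y)"
        by (intro infsumI) (simp add: mult_ac)
    qed
    also have "\<dots> = (\<Sum>\<^sub>\<infinity>y\<in>L. (if x = y then c x else 0) + gram_defect x y * c y)"
      by (intro infsum_cong) (auto simp: algebra_simps)
    also have "\<dots> = (\<Sum>\<^sub>\<infinity>y\<in>L. (if x = y then c x else 0)) + (\<Sum>\<^sub>\<infinity>y\<in>L. gram_defect x y * c y)"
    proof (rule infsum_add)
      show "(\<lambda>y. if x = y then c x else 0) summable_on L"
        by (rule has_sum_imp_summable[OF has_sum_finite_neutralI[of "{x}"]]) (use x in auto)
      have "(\<lambda>y. (cmod (gram_defect x y))\<^sup>2) summable_on L"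
        using summable_on_SigmaD1[of "\<lambda>x y. (cmod (gram_defect x y))\<^sup>2" L "\<lambda>_. L" x] gram_defect_summable x by simp
      thus "(\<lambda>y. gram_defect x y * c y) summable_on L" by (intro cauchy_schwarz_infsum_complex c)
    qed
    also have "(\<Sum>\<^sub>\<infinity>y\<in>L. (if x = y then c x else 0)) = c x"
      by (rule infsumI, rule has_sum_finite_neutralI[of "{x}"]) (use x in auto)
    finally show ?thesis using c_eq[OF x] by simp
  qed
  ultimately show thesis using that by blast
qed

end

section \<open>Normalised Dirichlet kernels\<close>

text \<open>The coefficients \<open>1 / (n + 1)\<close> are those of \<open>log (1 / (1 - u)) / u\<close>.\<close>

lemma dirichlet_kernel_sums:
  assumes "cmod z < 1" "cmod w < 1"
  shows "(\<lambda>n. (cnj z * w) ^ n / of_nat (Suc n)) sums dirichlet_kernel z w"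
proof -
  define u where "u = cnj z * w"
  have u: "cmod u < 1"
    using mult_strict_mono'[of "cmod z" 1 "cmod w" 1] assms by (simp add: u_def norm_mult)
  show ?thesis
  proof (cases "u = 0")
    case True
    have "(\<lambda>n. (1 / of_nat (Suc n)) * (0::complex) ^ n) sums (1 / of_nat (Suc 0))"
      by (rule powser_sums_zero)
    thus ?thesis using True unfolding dirichlet_kernel_def u_def[symmetric] by simp
  next
    case False
    have "Re (1 - u) > 0" using complex_Re_le_cmod[of u] u by simp
    hence "1 - u \<notin> \<real>\<^sub>\<le>\<^sub>0" by (auto simp: complex_nonpos_Reals_iff)
    hence Ln: "Ln (1 / (1 - u)) = - Ln (1 - u)"
      using Ln_inverse[of "1 - u"] by (simp add: divide_inverse)
    have "(\<lambda>n. u ^ n / of_nat n) sums - Ln (1 - u)"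
      using sums_minus[OF Ln_series'[of "- u"]] u by simp
    hence "(\<lambda>n. u ^ Suc n / of_nat (Suc n)) sums - Ln (1 - u)"
      by (subst sums_Suc_iff) simp
    from sums_divide[OF this, of u] show ?thesis
      using False unfolding dirichlet_kernel_def u_def[symmetric] Ln by simp
  qed
qed

lemma dirichlet_kernel_diag_sums_Re:
  assumes z: "cmod z < 1"
  shows "(\<lambda>n. cmod z ^ (2 * n) / real (Suc n)) sums Re (dirichlet_kernel z z)"
proof -
  have eq: "(cnj z * z) ^ n / of_nat (Suc n) = complex_of_real (cmod z ^ (2 * n) / real (Suc n))" for n
  proof -
    have "cnj z * z = complex_of_real ((cmod z)\<^sup>2)"
      using complex_norm_square[of z] by (simp add: mult.commute)
    thus ?thesis by (simp only: of_real_divide of_real_power of_real_of_nat_eq power_mult)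
  qed
  from sums_Re[OF dirichlet_kernel_sums[OF z z, unfolded eq]] show ?thesis
    by (simp only: Re_complex_of_real)
qed

lemma dirichlet_kernel_diag_ge_1:
  assumes "cmod z < 1"
  shows "1 \<le> Re (dirichlet_kernel z z)"
proof -
  have "(\<Sum>n<1. cmod z ^ (2 * n) / real (Suc n)) \<le> Re (dirichlet_kernel z z)"
    using dirichlet_kernel_diag_sums_Re[OF assms] sum_le_suminf[of "\<lambda>n. cmod z ^ (2 * n) / real (Suc n)" "{..<1}"]
    by (simp only: sums_iff) simp
  thus ?thesis by simp
qed

lemma dirichlet_kernel_diag_sums:
  assumes "cmod z < 1"
  shows "(\<lambda>n. cmod z ^ (2 * n) / real (Suc n)) sums (kernel_norm z)\<^sup>2"
  using dirichlet_kernel_diag_sums_Re[OF assms] dirichlet_kernel_diag_ge_1[OF assms]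
  by (simp only: kernel_norm_def) simp

lemma kernel_norm_ge_1: "cmod z < 1 \<Longrightarrow> 1 \<le> kernel_norm z"
  using dirichlet_kernel_diag_ge_1 by (simp add: kernel_norm_def)

text \<open>Coordinates of the normalised kernel at \<open>z\<close>, conjugated, in the orthonormal basis
  \<open>w\<^sup>n / sqrt (n + 1)\<close>. The conjugation makes the pairing with the coordinates of \<open>f\<close> bilinear:
  it evaluates \<open>f\<close> at \<open>z\<close> and divides by \<open>\<parallel>k\<^sub>z\<parallel>\<close>.\<close>

definition kernel_coord :: "complex \<Rightarrow> nat \<Rightarrow> complex" where
  "kernel_coord z n = z ^ n / of_real (sqrt (Suc n) * kernel_norm z)"

definition offdiag_gram :: "complex \<Rightarrow> complex \<Rightarrow> complex" where
  "offdiag_gram z w = (if z = w then 0 else dirichlet_kernel w z / of_real (kernel_norm z * kernel_norm w))"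

lemma norm_kernel_coord:
  assumes "cmod z < 1"
  shows "cmod (kernel_coord z n) = cmod z ^ n / (sqrt (Suc n) * kernel_norm z)"
  using kernel_norm_ge_1[OF assms]
  by (simp add: kernel_coord_def norm_divide norm_power norm_mult del: of_nat_Suc)

lemma kernel_coord_square_has_sum:
  assumes z: "cmod z < 1"
  shows "((\<lambda>n. (cmod (kernel_coord z n))\<^sup>2) has_sum 1) UNIV"
proof -
  have k: "kernel_norm z > 0" using kernel_norm_ge_1[OF z] by simp
  have "(\<lambda>n. cmod z ^ (2 * n) / real (Suc n) / (kernel_norm z)\<^sup>2) sums ((kernel_norm z)\<^sup>2 / (kernel_norm z)\<^sup>2)"
    by (intro sums_divide dirichlet_kernel_diag_sums z)
  moreover have "(cmod (kernel_coord z n))\<^sup>2 = cmod z ^ (2 * n) / real (Suc n) / (kernel_norm z)\<^sup>2" for n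
    by (simp add: norm_kernel_coord[OF z] power_divide power_mult_distrib power_mult[symmetric]
        mult.commute[of n 2] del: of_nat_Suc)
  ultimately show ?thesis using k by (intro sums_nonneg_imp_has_sum) auto
qed

lemma kernel_coord_summable:
  assumes z: "cmod z < 1"
  shows "(\<lambda>n. cmod (kernel_coord z n)) summable_on UNIV"
proof (rule summable_on_comparison_test)
  show "(\<lambda>n. cmod z ^ n) summable_on UNIV"
    using z by (intro summable_nonneg_imp_summable_on summable_geometric) auto
  have "1 * 1 \<le> sqrt (Suc n) * kernel_norm z" for n
    using kernel_norm_ge_1[OF z] by (intro mult_mono) auto
  thus "cmod (kernel_coord z n) \<le> cmod z ^ n" for n
    using frac_le[of "cmod z ^ n" "cmod z ^ n" 1 "sqrt (Suc n) * kernel_norm z"]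
    by (simp add: norm_kernel_coord[OF z])
qed auto

lemma kernel_coord_le:
  assumes z: "cmod z < 1"
  shows "cmod (kernel_coord z n) \<le> 1 / kernel_norm z"
proof -
  have "1 * kernel_norm z \<le> sqrt (Suc n) * kernel_norm z"
    using kernel_norm_ge_1[OF z] by (intro mult_right_mono) auto
  thus ?thesis
    using kernel_norm_ge_1[OF z] z unfolding norm_kernel_coord[OF z]
    by (intro frac_le) (auto simp: power_le_one)
qed

lemma kernel_coord_gram:
  assumes z: "cmod z < 1" and w: "cmod w < 1"
  shows "(\<Sum>\<^sub>\<infinity>n. kernel_coord z n * cnj (kernel_coord w n))
      = dirichlet_kernel w z / of_real (kernel_norm z * kernel_norm w)"
proof -
  define K where "K = complex_of_real (kernel_norm z * kernel_norm w)"
  have eq: "kernel_coord z n * cnj (kernel_coord w n) = (cnj w * z) ^ n / of_nat (Suc n) / K" for n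
  proof -
    have "complex_of_real (sqrt (Suc n)) * of_real (sqrt (Suc n)) = of_nat (Suc n)"
      by (simp flip: of_real_mult del: of_nat_Suc)
    thus ?thesis
      by (simp add: kernel_coord_def K_def power_mult_distrib mult_ac del: of_nat_Suc)
  qed
  have sums: "(\<lambda>n. kernel_coord z n * cnj (kernel_coord w n)) sums (dirichlet_kernel w z / K)"
    unfolding eq by (intro sums_divide dirichlet_kernel_sums w z)
  have "(\<lambda>n. kernel_coord z n * cnj (kernel_coord w n)) summable_on UNIV"
    using kernel_coord_square_has_sum z w
    by (intro cauchy_schwarz_infsum_complex) (auto intro: has_sum_imp_summable)
  hence "(\<lambda>n. kernel_coord z n * cnj (kernel_coord w n)) sums (\<Sum>\<^sub>\<infinity>n. kernel_coord z n * cnj (kernel_coord w n))"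
    by (intro has_sum_imp_sums has_sum_infsum)
  with sums show ?thesis unfolding K_def by (metis sums_unique2)
qed

lemma dirichlet_space_coeffs:
  "f \<in> dirichlet_space \<longleftrightarrow>
    (\<exists>a. (\<forall>z. cmod z < 1 \<longrightarrow> (\<lambda>n. a n * z ^ n) sums f z) \<and> summable (\<lambda>n. Suc n * (cmod (a n))\<^sup>2))"
proof
  assume f: "f \<in> dirichlet_space"
  define a where "a = (\<lambda>n. (deriv ^^ n) f 0 / fact n)"
  have a: "(\<lambda>n. a n * z ^ n) sums f z" if "cmod z < 1" for z
    using holomorphic_power_series[of f 0 1 z] f that by (simp add: a_def dirichlet_space_def)
  thus "\<exists>a. (\<forall>z. cmod z < 1 \<longrightarrow> (\<lambda>n. a n * z ^ n) sums f z) \<and> summable (\<lambda>n. Suc n * (cmod (a n))\<^sup>2)"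
    using power_series_in_dirichlet_space_iff[of a f] f by blast
qed (use power_series_in_dirichlet_space_iff in blast)

lemma dirichlet_space_of_coeffs:
  fixes a :: "nat \<Rightarrow> complex"
  assumes "summable (\<lambda>n. Suc n * (cmod (a n))\<^sup>2)"
  shows "(\<lambda>z. \<Sum>n. a n * z ^ n) \<in> dirichlet_space"
    and "cmod z < 1 \<Longrightarrow> (\<lambda>n. a n * z ^ n) sums (\<Sum>n. a n * z ^ n)"
proof -
  have sums: "(\<lambda>n. a n * z ^ n) sums (\<Sum>n. a n * z ^ n)" if z: "cmod z < 1" for z
  proof (rule summable_sums, rule summable_comparison_test')
    have "summable (\<lambda>n. (cmod (a n))\<^sup>2)"
      by (rule summable_comparison_test'[OF assms]) (simp add: mult_right_mono[of 1 "real (Suc _)", simplified])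
    moreover have "summable (\<lambda>n. ((cmod z)\<^sup>2) ^ n)"
      using z by (intro summable_geometric) (simp add: power_less_one_iff)
    ultimately show "summable (\<lambda>n. (cmod (a n))\<^sup>2 + ((cmod z)\<^sup>2) ^ n)" by (rule summable_add)
    show "norm (a n * z ^ n) \<le> (cmod (a n))\<^sup>2 + ((cmod z)\<^sup>2) ^ n" for n
    proof -
      have "2 * (cmod (a n) * cmod z ^ n) \<le> (cmod (a n))\<^sup>2 + (cmod z ^ n)\<^sup>2"
        using sum_squares_bound[of "cmod (a n)" "cmod z ^ n"] by (simp add: mult.assoc)
      moreover have "0 \<le> cmod (a n) * cmod z ^ n" by simp
      ultimately have "cmod (a n) * cmod z ^ n \<le> (cmod (a n))\<^sup>2 + (cmod z ^ n)\<^sup>2" by linarith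
      thus ?thesis
        by (simp add: norm_mult norm_power power_mult[symmetric] mult.commute[of 2 n])
    qed
  qed
  thus "cmod z < 1 \<Longrightarrow> (\<lambda>n. a n * z ^ n) sums (\<Sum>n. a n * z ^ n)" .
  show "(\<lambda>z. \<Sum>n. a n * z ^ n) \<in> dirichlet_space"
    unfolding dirichlet_space_coeffs using sums assms by blast
qed

lemma restriction_op_coords:
  fixes a :: "nat \<Rightarrow> complex"
  assumes f: "\<And>z. cmod z < 1 \<Longrightarrow> (\<lambda>n. a n * z ^ n) sums f z" and z: "cmod z < 1"
  shows "(\<Sum>\<^sub>\<infinity>n. of_real (sqrt (Suc n)) * a n * kernel_coord z n) = restriction_op f z"
proof -
  have eq: "of_real (sqrt (Suc n)) * a n * kernel_coord z n = a n * z ^ n / of_real (kernel_norm z)" for n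
    by (simp add: kernel_coord_def del: of_nat_Suc)
  have "((\<lambda>n. a n * z ^ n) has_sum f z) UNIV"
    by (rule norm_summable_imp_has_sum[OF power_series_disc_abs_summable[OF f z] f[OF z]])
  hence "((\<lambda>n. a n * z ^ n * inverse (of_real (kernel_norm z))) has_sum f z * inverse (of_real (kernel_norm z))) UNIV"
    by (rule has_sum_cmult_left)
  thus ?thesis unfolding eq by (intro infsumI) (simp add: restriction_op_def divide_inverse)
qed

text \<open>The normalised kernels are almost orthonormal, and \<open>restriction_op\<close> is the pairing with them. So
  the Bessel inequality gives the embedding into \<open>\<ell>\<^sup>2\<close>, and solvability of the moment problem gives
  surjectivity.\<close>

lemma universal_interpolating_if_gram_small:
  assumes L: "L \<subseteq> ball 0 1" and w: "(\<lambda>z. 1 / (kernel_norm z)\<^sup>2) summable_on L"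
    and gram: "(\<lambda>(z, w). (cmod (offdiag_gram z w))\<^sup>2) summable_on L \<times> L"
    and small: "(\<Sum>\<^sub>\<infinity>(z, w)\<in>L \<times> L. (cmod (offdiag_gram z w))\<^sup>2) < 1"
  shows "universal_interpolating L"
proof -
  have L1: "cmod z < 1" if "z \<in> L" for z using that L by auto
  have gram_eq: "(if z = w then 0 else \<Sum>\<^sub>\<infinity>n. kernel_coord z n * cnj (kernel_coord w n)) = offdiag_gram z w"
    if "z \<in> L" "w \<in> L" for z w
    using kernel_coord_gram L1 that by (simp add: offdiag_gram_def)
  interpret almost_orthonormal L kernel_coord "\<lambda>z. 1 / kernel_norm z"
  proof
    show "(\<lambda>z. (1 / kernel_norm z)\<^sup>2) summable_on L" using w by (simp add: power_divide)
    show "(\<lambda>(z, w). (cmod (if z = w then 0 else \<Sum>\<^sub>\<infinity>n. kernel_coord z n * cnj (kernel_coord w n)))\<^sup>2) summable_on L \<times> L"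
      by (rule summable_on_cong[THEN iffD1, OF _ gram]) (auto simp: gram_eq)
    have "(\<Sum>\<^sub>\<infinity>(z, w)\<in>L \<times> L. (cmod (if z = w then 0 else \<Sum>\<^sub>\<infinity>n. kernel_coord z n * cnj (kernel_coord w n)))\<^sup>2)
        = (\<Sum>\<^sub>\<infinity>(z, w)\<in>L \<times> L. (cmod (offdiag_gram z w))\<^sup>2)"
      by (rule infsum_cong) (auto simp: gram_eq)
    thus "(\<Sum>\<^sub>\<infinity>(z, w)\<in>L \<times> L. (cmod (if z = w then 0 else \<Sum>\<^sub>\<infinity>n. kernel_coord z n * cnj (kernel_coord w n)))\<^sup>2) < 1"
      using small by simp
  qed (use L1 in \<open>auto intro: kernel_coord_le kernel_coord_summable infsumI kernel_coord_square_has_sum\<close>)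
  have "restriction_op f \<in> ell2 L" if f: "f \<in> dirichlet_space" for f
  proof -
    obtain a where a: "\<And>z. cmod z < 1 \<Longrightarrow> (\<lambda>n. a n * z ^ n) sums f z" "summable (\<lambda>n. Suc n * (cmod (a n))\<^sup>2)"
      using f unfolding dirichlet_space_coeffs by blast
    have "(\<lambda>n. (cmod (of_real (sqrt (Suc n)) * a n))\<^sup>2) summable_on UNIV"
      using a(2) by (intro summable_nonneg_imp_summable_on) (auto simp: norm_mult power_mult_distrib simp del: of_nat_Suc)
    from bessel_inequality(1)[OF this] show ?thesis
      unfolding ell2_def mem_Collect_eq
      by (rule summable_on_cong[THEN iffD1, rotated]) (simp only: restriction_op_coords[OF a(1) L1])
  qed
  moreover have "\<exists>f\<in>dirichlet_space. \<forall>z\<in>L. restriction_op f z = a z" if "a \<in> ell2 L" for a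
  proof -
    have "(\<lambda>z. (cmod (a z))\<^sup>2) summable_on L" using that by (simp add: ell2_def)
    then obtain \<alpha> where \<alpha>: "(\<lambda>n. (cmod (\<alpha> n))\<^sup>2) summable_on UNIV"
      and eq: "\<And>z. z \<in> L \<Longrightarrow> (\<Sum>\<^sub>\<infinity>n. \<alpha> n * kernel_coord z n) = a z"
      using moment_problem_solvable[of a] by metis
    define b where "b = (\<lambda>n. \<alpha> n / of_real (sqrt (Suc n)))"
    have \<alpha>_eq: "of_real (sqrt (Suc n)) * b n = \<alpha> n" for n by (simp add: b_def del: of_nat_Suc)
    have b: "summable (\<lambda>n. Suc n * (cmod (b n))\<^sup>2)"
      using summable_on_imp_summable[OF \<alpha>]
      by (simp add: b_def norm_divide power_divide del: of_nat_Suc)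
    have "restriction_op (\<lambda>z. \<Sum>n. b n * z ^ n) z = a z" if "z \<in> L" for z
      using restriction_op_coords[OF dirichlet_space_of_coeffs(2)[OF b] L1[OF that]] eq[OF that]
      unfolding \<alpha>_eq by simp
    thus ?thesis using dirichlet_space_of_coeffs(1)[OF b] by blast
  qed
  ultimately show ?thesis using L by (simp add: universal_interpolating_def)
qed

section \<open>Deterministic interpolation\<close>

lemma dirichlet_spaceE:
  assumes "f \<in> dirichlet_space"
  obtains a where "\<And>z. cmod z < 1 \<Longrightarrow> (\<lambda>n. a n * z ^ n) sums f z" "summable (\<lambda>n. Suc n * (cmod (a n))\<^sup>2)"
  using assms unfolding dirichlet_space_coeffs by blast

lemma dirichlet_spaceI:
  assumes "\<And>z. cmod z < 1 \<Longrightarrow> (\<lambda>n. a n * z ^ n) sums f z" "summable (\<lambda>n. Suc n * (cmod (a n))\<^sup>2)"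
  shows "f \<in> dirichlet_space"
  using assms unfolding dirichlet_space_coeffs by blast

lemma dirichlet_space_add:
  assumes "f \<in> dirichlet_space" "g \<in> dirichlet_space"
  shows "(\<lambda>z. f z + g z) \<in> dirichlet_space"
proof -
  obtain a where a: "\<And>z. cmod z < 1 \<Longrightarrow> (\<lambda>n. a n * z ^ n) sums f z" "summable (\<lambda>n. Suc n * (cmod (a n))\<^sup>2)"
    using dirichlet_spaceE[OF assms(1)] by blast
  obtain b where b: "\<And>z. cmod z < 1 \<Longrightarrow> (\<lambda>n. b n * z ^ n) sums g z" "summable (\<lambda>n. Suc n * (cmod (b n))\<^sup>2)"
    using dirichlet_spaceE[OF assms(2)] by blast
  have "(\<lambda>n. (a n + b n) * z ^ n) sums (f z + g z)" if "cmod z < 1" for z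
    using sums_add[OF a(1)[OF that] b(1)[OF that]] by (simp add: algebra_simps)
  moreover have "summable (\<lambda>n. Suc n * (cmod (a n + b n))\<^sup>2)"
  proof (rule summable_comparison_test'[where N = 0])
    show "summable (\<lambda>n. 2 * (Suc n * (cmod (a n))\<^sup>2) + 2 * (Suc n * (cmod (b n))\<^sup>2))"
      by (intro summable_add summable_mult a b)
    fix n
    have "(cmod (a n + b n))\<^sup>2 \<le> (cmod (a n) + cmod (b n))\<^sup>2"
      by (intro power_mono norm_triangle_ineq) auto
    also have "\<dots> \<le> 2 * (cmod (a n))\<^sup>2 + 2 * (cmod (b n))\<^sup>2"
      using sum_squares_bound[of "cmod (a n)" "cmod (b n)"] by (simp add: power2_sum)
    finally have "Suc n * (cmod (a n + b n))\<^sup>2 \<le> Suc n * (2 * (cmod (a n))\<^sup>2 + 2 * (cmod (b n))\<^sup>2)"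
      by (rule mult_left_mono) simp
    thus "norm (Suc n * (cmod (a n + b n))\<^sup>2) \<le> 2 * (Suc n * (cmod (a n))\<^sup>2) + 2 * (Suc n * (cmod (b n))\<^sup>2)"
      by (simp add: algebra_simps)
  qed
  ultimately show ?thesis by (rule dirichlet_spaceI)
qed

lemma dirichlet_space_cmult:
  assumes "f \<in> dirichlet_space"
  shows "(\<lambda>z. c * f z) \<in> dirichlet_space"
proof -
  obtain a where a: "\<And>z. cmod z < 1 \<Longrightarrow> (\<lambda>n. a n * z ^ n) sums f z" "summable (\<lambda>n. Suc n * (cmod (a n))\<^sup>2)"
    using dirichlet_spaceE[OF assms] by blast
  have "(\<lambda>n. (c * a n) * z ^ n) sums (c * f z)" if "cmod z < 1" for z
    using sums_mult[OF a(1)[OF that], of c] by (simp add: mult.assoc)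
  moreover have "summable (\<lambda>n. Suc n * (cmod (c * a n))\<^sup>2)"
    using summable_mult[OF a(2), of "(cmod c)\<^sup>2"] by (simp add: norm_mult power_mult_distrib mult_ac)
  ultimately show ?thesis by (rule dirichlet_spaceI)
qed

lemma dirichlet_space_const: "(\<lambda>z. c) \<in> dirichlet_space"
proof -
  have "(\<lambda>n. (if n = 0 then c else 0) * z ^ n) sums c" for z :: complex
  proof -
    have eq: "(if n = 0 then c else 0) * z ^ n = c * ((if n = 0 then 1 else 0) * z ^ n)" for n by simp
    show ?thesis unfolding eq using sums_mult[OF powser_sums_if[of 0 z], of c] by simp
  qed
  moreover have "summable (\<lambda>n. Suc n * (cmod (if n = 0 then c else 0))\<^sup>2)"
    by (rule summable_finite[of "{0}"]) auto
  ultimately show ?thesis by (rule dirichlet_spaceI)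
qed

lemma dirichlet_space_mult_id:
  assumes "f \<in> dirichlet_space"
  shows "(\<lambda>z. z * f z) \<in> dirichlet_space"
proof -
  obtain a where a: "\<And>z. cmod z < 1 \<Longrightarrow> (\<lambda>n. a n * z ^ n) sums f z" "summable (\<lambda>n. Suc n * (cmod (a n))\<^sup>2)"
    using dirichlet_spaceE[OF assms] by blast
  define b where "b = (\<lambda>n. case n of 0 \<Rightarrow> 0 | Suc m \<Rightarrow> a m)"
  have "(\<lambda>n. b n * z ^ n) sums (z * f z)" if "cmod z < 1" for z
  proof -
    have "(\<lambda>n. b (Suc n) * z ^ Suc n) sums (z * f z)"
      using sums_mult[OF a(1)[OF that], of z] by (simp add: b_def mult_ac)
    from sums_Suc_imp[OF _ this] show ?thesis by (simp add: b_def)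
  qed
  moreover have "summable (\<lambda>n. Suc n * (cmod (b n))\<^sup>2)"
  proof (subst summable_Suc_iff[symmetric], rule summable_comparison_test'[where N = 0])
    show "summable (\<lambda>n. 2 * (Suc n * (cmod (a n))\<^sup>2))" by (intro summable_mult a)
    show "norm (real (Suc (Suc n)) * (cmod (b (Suc n)))\<^sup>2) \<le> 2 * (Suc n * (cmod (a n))\<^sup>2)" for n
      by (auto simp: b_def simp flip: mult.assoc intro!: mult_right_mono)
  qed
  ultimately show ?thesis by (rule dirichlet_spaceI)
qed

lemma summable_on_imp_finite_ge:
  fixes f :: "'a \<Rightarrow> real"
  assumes f: "f summable_on A" and pos: "\<And>x. x \<in> A \<Longrightarrow> 0 \<le> f x" and \<epsilon>: "\<epsilon> > 0"
  shows "finite {x \<in> A. \<epsilon> \<le> f x}"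
proof (rule ccontr)
  assume "infinite {x \<in> A. \<epsilon> \<le> f x}"
  moreover obtain n :: nat where n: "(\<Sum>\<^sub>\<infinity>x\<in>A. f x) < n * \<epsilon>"
    using reals_Archimedean3[OF \<epsilon>] by blast
  ultimately obtain F where F: "F \<subseteq> {x \<in> A. \<epsilon> \<le> f x}" "card F = n" "finite F"
    using infinite_arbitrarily_large by metis
  have "n * \<epsilon> \<le> (\<Sum>x\<in>F. f x)"
    using sum_mono[of F "\<lambda>_. \<epsilon>" f] F by auto
  also have "\<dots> \<le> (\<Sum>\<^sub>\<infinity>x\<in>A. f x)"
    using F f pos by (intro finite_sum_le_infsum) auto
  finally show False using n by simp
qed

text \<open>The constant function 1 belongs to the Dirichlet space.\<close>

lemma universal_interpolating_imp_summable:
  assumes "universal_interpolating L"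
  shows "(\<lambda>z. 1 / (kernel_norm z)\<^sup>2) summable_on L"
proof -
  have "restriction_op (\<lambda>_. 1) \<in> ell2 L"
    using assms dirichlet_space_const unfolding universal_interpolating_def by blast
  thus ?thesis
    by (simp add: ell2_def restriction_op_def norm_divide power_divide)
qed

lemma kernel_norm_square_le:
  assumes "cmod z < 1"
  shows "(kernel_norm z)\<^sup>2 \<le> 1 / (1 - (cmod z)\<^sup>2)"
proof (rule sums_le[OF _ dirichlet_kernel_diag_sums[OF assms]])
  show "(\<lambda>n. ((cmod z)\<^sup>2) ^ n) sums (1 / (1 - (cmod z)\<^sup>2))"
    using assms by (intro geometric_sums) (simp add: power_less_one_iff)
  show "cmod z ^ (2 * n) / real (Suc n) \<le> ((cmod z)\<^sup>2) ^ n" for n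
    using frac_le[of "cmod z ^ (2 * n)" "cmod z ^ (2 * n)" 1 "real (Suc n)"] by (simp add: power_mult)
qed

text \<open>Kernel norms are bounded on compact subsets of the disc, so a convergent sum of \<open>1 / \<parallel>k\<^sub>z\<parallel>\<^sup>2\<close>
  allows only finitely many points in each of them, and \<open>p\<close> cannot be a limit of points of \<open>L\<close>.\<close>

lemma universal_interpolating_separated_from:
  assumes L: "L \<subseteq> ball 0 1" "(\<lambda>z. 1 / (kernel_norm z)\<^sup>2) summable_on L"
    and p: "cmod p < 1" "p \<notin> L"
  obtains \<delta> where "\<delta> > 0" "\<And>z. z \<in> L \<Longrightarrow> \<delta> \<le> cmod (z - p)"
proof -
  obtain r where r: "cmod p < r" "r < 1" using dense p(1) by blast
  have r0: "0 < r" using r norm_ge_zero[of p] by linarith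
  define \<epsilon> where "\<epsilon> = 1 - r\<^sup>2"
  have \<epsilon>: "\<epsilon> > 0" using r r0 by (simp add: \<epsilon>_def power_less_one_iff)
  have "{z \<in> L. cmod z \<le> r} \<subseteq> {z \<in> L. \<epsilon> \<le> 1 / (kernel_norm z)\<^sup>2}"
  proof safe
    fix z assume z: "z \<in> L" "cmod z \<le> r"
    hence z1: "cmod z < 1" using r by simp
    have "(kernel_norm z)\<^sup>2 \<le> 1 / (1 - (cmod z)\<^sup>2)" by (rule kernel_norm_square_le[OF z1])
    also have "\<dots> \<le> 1 / \<epsilon>"
      using \<epsilon> z power_mono[OF z(2), of 2] by (intro divide_left_mono mult_pos_pos) (auto simp: \<epsilon>_def)
    finally show "\<epsilon> \<le> 1 / (kernel_norm z)\<^sup>2"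
      using \<epsilon> kernel_norm_ge_1[OF z1] by (simp add: field_simps)
  qed
  hence fin: "finite {z \<in> L. cmod z \<le> r}"
    by (rule finite_subset) (intro summable_on_imp_finite_ge L \<epsilon>, auto)
  obtain d where d: "d > 0" "\<And>z. z \<in> {z \<in> L. cmod z \<le> r} \<Longrightarrow> z \<noteq> p \<Longrightarrow> d \<le> dist p z"
    using finite_set_avoid[OF fin, of p] by blast
  show thesis
  proof (rule that)
    show "min d (r - cmod p) > 0" using d r by simp
    fix z assume z: "z \<in> L"
    show "min d (r - cmod p) \<le> cmod (z - p)"
    proof (cases "cmod z \<le> r")
      case True
      moreover have "z \<noteq> p" using z p by blast
      ultimately show ?thesis using d(2)[of z] z by (auto simp: dist_norm norm_minus_commute)
    next
      case False
      thus ?thesis using norm_triangle_ineq2[of z p] by simp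
    qed
  qed
qed

text \<open>The interpolant is \<open>f(z) = b + (z - p) h(z)\<close>. The constant \<open>b\<close> fixes the value at \<open>p\<close>; the values
  that \<open>h\<close> must take on \<open>L\<close> involve division by \<open>z - p\<close>, which is harmless because \<open>L\<close> keeps a
  positive distance from \<open>p\<close>.\<close>

lemma universal_interpolating_insert:
  assumes UI: "universal_interpolating L" and p: "cmod p < 1" "p \<notin> L"
  shows "universal_interpolating (insert p L)"
proof -
  have L: "L \<subseteq> ball 0 1" and carleson: "\<And>f. f \<in> dirichlet_space \<Longrightarrow> restriction_op f \<in> ell2 L"
    and onto: "\<And>a. a \<in> ell2 L \<Longrightarrow> \<exists>f\<in>dirichlet_space. \<forall>z\<in>L. restriction_op f z = a z"
    using UI unfolding universal_interpolating_def by blast+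
  obtain \<delta> where \<delta>: "\<delta> > 0" "\<And>z. z \<in> L \<Longrightarrow> \<delta> \<le> cmod (z - p)"
    using universal_interpolating_separated_from[OF L universal_interpolating_imp_summable[OF UI] p] by blast
  have "restriction_op f \<in> ell2 (insert p L)" if "f \<in> dirichlet_space" for f
    using carleson[OF that] by (simp add: ell2_def summable_on_insert_iff)
  moreover have "\<exists>f\<in>dirichlet_space. \<forall>z\<in>insert p L. restriction_op f z = a z" if a: "a \<in> ell2 (insert p L)" for a
  proof -
    define b where "b = a p * of_real (kernel_norm p)"
    define g where "g = (\<lambda>z. (a z + restriction_op (\<lambda>_. - b) z) / (z - p))"
    have num: "(\<lambda>z. (cmod (a z + restriction_op (\<lambda>_. - b) z))\<^sup>2) summable_on L"
    proof (rule summable_on_square_add)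
      show "(\<lambda>z. (cmod (a z))\<^sup>2) summable_on L"
        using a by (simp add: ell2_def summable_on_insert_iff)
      show "(\<lambda>z. (cmod (restriction_op (\<lambda>_. - b) z))\<^sup>2) summable_on L"
        using carleson[OF dirichlet_space_const] by (simp add: ell2_def)
    qed
    have "g \<in> ell2 L"
      unfolding ell2_def mem_Collect_eq
    proof (rule summable_on_comparison_test)
      show "(\<lambda>z. (1 / \<delta>\<^sup>2) * (cmod (a z + restriction_op (\<lambda>_. - b) z))\<^sup>2) summable_on L"
        by (intro summable_on_cmult_right num)
      fix z assume z: "z \<in> L"
      have "(cmod (g z))\<^sup>2 = (cmod (a z + restriction_op (\<lambda>_. - b) z))\<^sup>2 / (cmod (z - p))\<^sup>2"
        by (simp add: g_def norm_divide power_divide)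
      also have "\<dots> \<le> (cmod (a z + restriction_op (\<lambda>_. - b) z))\<^sup>2 / \<delta>\<^sup>2"
        using \<delta>(1) \<delta>(2)[OF z] by (intro frac_le power_mono) auto
      finally show "(cmod (g z))\<^sup>2 \<le> (1 / \<delta>\<^sup>2) * (cmod (a z + restriction_op (\<lambda>_. - b) z))\<^sup>2" by simp
    qed auto
    then obtain h where h: "h \<in> dirichlet_space" "\<And>z. z \<in> L \<Longrightarrow> restriction_op h z = g z"
      using onto by blast
    define f where "f = (\<lambda>z. (z * h z + (- p) * h z) + b)"
    have "f \<in> dirichlet_space"
      unfolding f_def by (intro dirichlet_space_add dirichlet_space_mult_id dirichlet_space_cmult dirichlet_space_const h)
    moreover have "restriction_op f p = a p"
      using kernel_norm_ge_1[OF p(1)] by (simp add: f_def restriction_op_def b_def)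
    moreover have "restriction_op f z = a z" if z: "z \<in> L" for z
    proof -
      have "z \<noteq> p" using z p by blast
      have "restriction_op f z = (z - p) * restriction_op h z - restriction_op (\<lambda>_. - b) z"
        by (simp add: restriction_op_def f_def algebra_simps add_divide_distrib diff_divide_distrib)
      also have "\<dots> = a z" using \<open>z \<noteq> p\<close> by (simp add: h(2)[OF z] g_def)
      finally show ?thesis .
    qed
    ultimately show ?thesis by blast
  qed
  ultimately show ?thesis using L p by (simp add: universal_interpolating_def)
qed

lemma universal_interpolating_Un_finite:
  assumes "finite F" "universal_interpolating L" "F \<subseteq> ball 0 1"
  shows "universal_interpolating (L \<union> F)"
  using assms
proof (induction F rule: finite_induct)
  case (insert p F)
  have UI: "universal_interpolating (L \<union> F)" and p: "cmod p < 1" using insert by auto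
  show ?case
  proof (cases "p \<in> L \<union> F")
    case True
    hence "L \<union> insert p F = L \<union> F" by blast
    thus ?thesis using UI by simp
  next
    case False
    thus ?thesis using universal_interpolating_insert[OF UI p] by simp
  qed
qed simp

text \<open>All but a small part of a convergent double sum is carried by finitely many pairs. Without the
  points of these pairs the off-diagonal Gram matrix is small; they are then inserted again.\<close>

theorem universal_interpolating_if_gram_hilbert_schmidt:
  assumes L: "L \<subseteq> ball 0 1" and w: "(\<lambda>z. 1 / (kernel_norm z)\<^sup>2) summable_on L"
    and gram: "(\<lambda>(z, w). (cmod (offdiag_gram z w))\<^sup>2) summable_on L \<times> L"
  shows "universal_interpolating L"
proof -
  define G where "G = (\<lambda>(z, w). (cmod (offdiag_gram z w))\<^sup>2)"
  have G: "G summable_on L \<times> L" using gram by (simp only: G_def)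
  have "\<exists>P. finite P \<and> P \<subseteq> L \<times> L \<and> dist (sum G P) (infsum G (L \<times> L)) \<le> 1 / 2"
    by (rule infsum_finite_approximation[OF G]) simp
  then obtain P where P: "finite P" "P \<subseteq> L \<times> L" "dist (sum G P) (infsum G (L \<times> L)) \<le> 1 / 2"
    by blast
  define F where "F = fst ` P \<union> snd ` P"
  have F: "finite F" using P(1) by (simp add: F_def)
  have FL: "F \<subseteq> L"
  proof
    fix x assume "x \<in> F"
    then obtain p where "p \<in> P" "x = fst p \<or> x = snd p" unfolding F_def by blast
    thus "x \<in> L" using P(2) mem_Times_iff[of p L L] by blast
  qed
  have sub: "(L - F) \<times> (L - F) \<subseteq> L \<times> L - P"
  proof
    fix p assume p: "p \<in> (L - F) \<times> (L - F)"
    hence "fst p \<notin> F" by (simp add: mem_Times_iff)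
    hence "p \<notin> P" using imageI[of p P fst] by (auto simp: F_def)
    thus "p \<in> L \<times> L - P" using p by (simp add: mem_Times_iff)
  qed
  have G1: "G summable_on (L - F) \<times> (L - F)" "G summable_on L \<times> L - P"
    by (rule summable_on_subset_banach[OF G]; blast)+
  have "infsum G ((L - F) \<times> (L - F)) \<le> infsum G (L \<times> L - P)"
    by (rule infsum_mono2[OF G1 sub]) (simp add: G_def case_prod_beta)
  also have "\<dots> = infsum G (L \<times> L) - sum G P"
    using infsum_Diff[OF G summable_on_finite[OF P(1)] P(2)] by (simp only: infsum_finite[OF P(1)])
  also have "\<dots> < 1" using P(3) unfolding dist_real_def by linarith
  finally have small: "infsum G ((L - F) \<times> (L - F)) < 1" .
  have "universal_interpolating (L - F)"
  proof (rule universal_interpolating_if_gram_small)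
    show "L - F \<subseteq> ball 0 1" using L by blast
    show "(\<lambda>z. 1 / (kernel_norm z)\<^sup>2) summable_on L - F" by (rule summable_on_subset_banach[OF w]) blast
    show "(\<lambda>(z, w). (cmod (offdiag_gram z w))\<^sup>2) summable_on (L - F) \<times> (L - F)"
      by (rule G1(1)[unfolded G_def])
    show "(\<Sum>\<^sub>\<infinity>(z, w)\<in>(L - F) \<times> (L - F). (cmod (offdiag_gram z w))\<^sup>2) < 1"
      by (rule small[unfolded G_def])
  qed
  hence "universal_interpolating ((L - F) \<union> F)"
    by (rule universal_interpolating_Un_finite[OF F]) (rule order_trans[OF FL L])
  moreover have "(L - F) \<union> F = L" using FL by blast
  ultimately show ?thesis by (rule back_subst)
qed

section \<open>Kernel norms on dyadic annuli\<close>

lemma summable_on_iff_nn_integral_finite: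
  fixes f :: "'a \<Rightarrow> real"
  assumes "\<And>x. x \<in> A \<Longrightarrow> 0 \<le> f x"
  shows "f summable_on A \<longleftrightarrow> (\<integral>\<^sup>+x. ennreal (f x) \<partial>count_space A) < \<infinity>"
proof -
  have "f summable_on A \<longleftrightarrow> Infinite_Sum.abs_summable_on f A"
    by (rule summable_on_iff_abs_summable_on_real)
  also have "\<dots> \<longleftrightarrow> Infinite_Set_Sum.abs_summable_on f A"
    by (rule abs_summable_equivalent)
  also have "\<dots> \<longleftrightarrow> (\<integral>\<^sup>+x. ennreal (norm (f x)) \<partial>count_space A) < \<infinity>"
    by (simp add: Infinite_Set_Sum.abs_summable_on_def integrable_iff_bounded)
  also have "(\<integral>\<^sup>+x. ennreal (norm (f x)) \<partial>count_space A) = (\<integral>\<^sup>+x. ennreal (f x) \<partial>count_space A)"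
    using assms by (intro nn_integral_cong) simp
  finally show ?thesis .
qed

lemma kernel_norm_radial:
  assumes "cmod z < 1" "cmod z = cmod w"
  shows "kernel_norm z = kernel_norm w"
proof -
  have "(kernel_norm z)\<^sup>2 = (kernel_norm w)\<^sup>2"
    using dirichlet_kernel_diag_sums[of z] dirichlet_kernel_diag_sums[of w] assms
    by (intro sums_unique2[of "\<lambda>n. cmod z ^ (2 * n) / real (Suc n)"]) auto
  thus ?thesis using kernel_norm_ge_1[of z] kernel_norm_ge_1[of w] assms
    by (simp add: power2_eq_iff_nonneg)
qed

lemma kernel_norm_square_of_real:
  assumes r: "0 < r" "r < 1"
  shows "(kernel_norm (complex_of_real r))\<^sup>2 = - ln (1 - r\<^sup>2) / r\<^sup>2"
proof -
  have r1: "r\<^sup>2 < 1" using r by (simp add: power_less_one_iff)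
  have "dirichlet_kernel (of_real r) (of_real r) = 1 / of_real (r\<^sup>2) * Ln (of_real (1 / (1 - r\<^sup>2)))"
    using r by (simp add: dirichlet_kernel_def power2_eq_square)
  also have "\<dots> = of_real (1 / r\<^sup>2 * ln (1 / (1 - r\<^sup>2)))"
    using r1 by (subst Ln_of_real) auto
  finally have "Re (dirichlet_kernel (of_real r) (of_real r)) = 1 / r\<^sup>2 * ln (1 / (1 - r\<^sup>2))"
    by (simp only: Re_complex_of_real)
  also have "\<dots> = - ln (1 - r\<^sup>2) / r\<^sup>2" using r1 by (simp add: ln_div)
  finally show ?thesis
    using dirichlet_kernel_diag_ge_1[of "of_real r"] r by (simp add: kernel_norm_def)
qed

text \<open>The squared norm is \<open>log (1 / (1 - r\<^sup>2)) / r\<^sup>2\<close>, and \<open>1 - r\<^sup>2\<close> lies between \<open>2\<^bsup>-n-1\<^esup>\<close> and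
  \<open>2\<^bsup>1-n\<^esup>\<close>. For \<open>n = 1\<close> the lower bound from the logarithm degenerates, and \<open>\<parallel>k\<^sub>r\<parallel> \<ge> 1\<close> takes
  over.\<close>

lemma kernel_norm_square_dyadic_bounds:
  assumes n: "1 \<le> n" and r: "r \<in> dyadic_interval n"
  shows "real n / 4 \<le> (kernel_norm (complex_of_real r))\<^sup>2" "(kernel_norm (complex_of_real r))\<^sup>2 \<le> 8 * real n"
proof -
  have lo: "1 - 1 / 2 ^ n \<le> r" and hi: "r < 1 - 1 / 2 ^ (n + 1)"
    using r by (auto simp: dyadic_interval_def)
  have "(1::real) / 2 ^ n \<le> 1 / 2 ^ 1" using n by (intro divide_left_mono power_increasing) auto
  hence "(1::real) / 2 ^ n \<le> 1 / 2" by simp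
  hence r2: "1 / 2 \<le> r" using lo by linarith
  have "(0::real) < 1 / 2 ^ (n + 1)" by simp
  hence r1: "r < 1" using hi by linarith
  have sq: "r\<^sup>2 < 1" "1 / 4 \<le> r\<^sup>2" "r\<^sup>2 \<le> r"
  proof -
    show "r\<^sup>2 \<le> r" using mult_left_mono[of r 1 r] r1 r2 by (simp add: power2_eq_square)
    thus "r\<^sup>2 < 1" using r1 by simp
    show "1 / 4 \<le> r\<^sup>2" using power_mono[OF r2, of 2] by (simp add: power2_eq_square)
  qed
  note eq = kernel_norm_square_of_real[of r]
  define x where "x = - ln (1 - r\<^sup>2)"
  have x0: "0 \<le> x" using sq by (simp add: x_def)
  have k: "(kernel_norm (complex_of_real r))\<^sup>2 = x / r\<^sup>2" using eq r1 r2 by (simp add: x_def)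
  have ge1: "1 \<le> (kernel_norm (complex_of_real r))\<^sup>2"
    using kernel_norm_ge_1[of "of_real r"] r1 r2 by simp
  have "(1 - r) * (1 + r) \<le> (1 / 2 ^ n) * 2"
    using lo r1 r2 by (intro mult_mono) auto
  hence "1 - r\<^sup>2 \<le> 2 / 2 ^ n" by (simp add: algebra_simps power2_eq_square)
  hence "ln (1 - r\<^sup>2) \<le> ln (2 / 2 ^ n)" using sq by (subst ln_le_cancel_iff) auto
  hence "(real n - 1) * ln 2 \<le> x" by (simp add: x_def ln_div ln_realpow algebra_simps)
  moreover have "(real n - 1) * (2 / 3) \<le> (real n - 1) * ln 2"
    using n ln2_ge_two_thirds by (intro mult_left_mono) auto
  moreover have "x \<le> x / r\<^sup>2"
    using x0 sq by (simp add: field_simps mult_left_le)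
  ultimately have growth: "(real n - 1) * (2 / 3) \<le> x / r\<^sup>2" by linarith
  have "real n = 1 \<or> 2 \<le> real n" using n by (cases "n = 1") auto
  thus "real n / 4 \<le> (kernel_norm (complex_of_real r))\<^sup>2"
  proof
    assume "real n = 1"
    thus ?thesis using ge1 by linarith
  next
    assume "2 \<le> real n"
    hence "real n / 4 \<le> (real n - 1) * (2 / 3)" by (simp add: field_simps)
    thus ?thesis unfolding k using growth by (rule order_trans)
  qed
  have "1 / 2 ^ (n + 1) \<le> 1 - r\<^sup>2" using hi sq by simp
  hence "ln (1 / 2 ^ (n + 1)) \<le> ln (1 - r\<^sup>2)" using sq by (subst ln_le_cancel_iff) auto
  hence "x \<le> real (n + 1) * ln 2" by (simp add: x_def ln_div ln_realpow del: power_Suc)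
  also have "\<dots> \<le> real (n + 1) * 1" using ln_2_less_1 by (intro mult_left_mono) auto
  also have "\<dots> \<le> 2 * real n" using n by simp
  finally have "x / r\<^sup>2 \<le> (2 * real n) / (1 / 4)"
    using sq x0 by (intro frac_le) auto
  thus "(kernel_norm (complex_of_real r))\<^sup>2 \<le> 8 * real n" unfolding k by simp
qed

lemma dyadic_interval_cover:
  assumes "1 / 2 \<le> r" "r < 1"
  obtains n where "r \<in> dyadic_interval (Suc n)"
proof -
  obtain N :: nat where "(1 / 2) ^ N < 1 - r"
    using real_arch_pow_inv[of "1 - r" "1 / 2"] assms by auto
  hence ex: "r < 1 - 1 / 2 ^ N" by (simp add: power_divide)
  define m where "m = (LEAST m. r < 1 - 1 / 2 ^ m)"
  have m: "r < 1 - 1 / 2 ^ m" unfolding m_def by (rule LeastI[of _ N]) (rule ex)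
  have m_le: "1 - 1 / 2 ^ i \<le> r" if "i < m" for i
    using not_less_Least[of i "\<lambda>m. r < 1 - 1 / 2 ^ m"] that unfolding m_def by simp
  have "m \<noteq> 0"
  proof
    assume "m = 0"
    with m assms show False by simp
  qed
  moreover have "m \<noteq> 1"
  proof
    assume "m = 1"
    with m assms show False by simp
  qed
  ultimately obtain n where n: "m = Suc (Suc n)" by (metis One_nat_def not0_implies_Suc)
  have "r \<in> dyadic_interval (Suc n)"
    using m m_le[of "Suc n"] unfolding n dyadic_interval_def by simp
  thus thesis by (rule that)
qed

lemma dyadic_interval_disjoint:
  assumes "r \<in> dyadic_interval m" "r \<in> dyadic_interval n"
  shows "m = n"
proof -
  have False if "r \<in> dyadic_interval m" "r \<in> dyadic_interval n" "m < n" for m n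
  proof -
    have "(1::real) / 2 ^ n \<le> 1 / 2 ^ (m + 1)"
      using that(3) by (intro divide_left_mono power_increasing) auto
    thus False using that(1,2) unfolding dyadic_interval_def atLeastLessThan_iff by linarith
  qed
  thus ?thesis using assms by (metis linorder_neqE_nat)
qed

lemma dyadic_interval_Suc_ge_half: "r \<in> dyadic_interval (Suc n) \<Longrightarrow> 1 / 2 \<le> r \<and> r < 1"
proof -
  assume r: "r \<in> dyadic_interval (Suc n)"
  have "(1::real) / 2 ^ Suc n \<le> 1 / 2" by simp
  moreover have "(0::real) < 1 / 2 ^ (Suc n + 1)" by simp
  ultimately show ?thesis using r unfolding dyadic_interval_def atLeastLessThan_iff by (intro conjI) linarith+
qed

text \<open>Both series sum, over the radii, a quantity comparable with \<open>1 / n\<close> on the \<open>n\<close>-th interval; the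
  first one groups the radii by intervals.\<close>

lemma annulus_count_series_finite_iff:
  fixes \<rho> :: "nat \<Rightarrow> real"
  assumes \<rho>: "\<And>k. \<rho> k < 1" and fin: "\<And>n. finite {k. \<rho> k \<in> dyadic_interval (Suc n)}"
  shows "(\<Sum>n. ennreal (real (annulus_count \<rho> (Suc n)) / real (Suc n))) < \<infinity>
      \<longleftrightarrow> (\<lambda>k. 1 / (kernel_norm (of_real (\<rho> k)))\<^sup>2) summable_on {k. 1 / 2 \<le> \<rho> k}"
proof -
  define J where "J = {k. 1 / 2 \<le> \<rho> k}"
  define W where "W = (\<lambda>k. 1 / (kernel_norm (of_real (\<rho> k)))\<^sup>2)"
  define u where "u = (\<lambda>n k. ennreal (1 / Suc n) * indicator {k. \<rho> k \<in> dyadic_interval (Suc n)} k)"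
  have "\<exists>n. \<rho> k \<in> dyadic_interval (Suc n)" if "k \<in> J" for k
    using dyadic_interval_cover[of "\<rho> k"] \<rho>[of k] that unfolding J_def by blast
  hence "\<forall>k\<in>J. \<exists>n. \<rho> k \<in> dyadic_interval (Suc n)" by (intro ballI)
  then obtain l where "\<forall>k\<in>J. \<rho> k \<in> dyadic_interval (Suc (l k))"
    by (rule bchoice[THEN exE])
  hence l: "\<rho> k \<in> dyadic_interval (Suc (l k))" if "k \<in> J" for k using that by (rule bspec)
  have total: "(\<Sum>n. u n k) = ennreal (1 / Suc (l k)) * indicator J k" for k
  proof (cases "k \<in> J")
    case True
    have "u n k = (if n = l k then ennreal (1 / Suc (l k)) else 0)" for n
    proof (cases "n = l k")
      case False
      hence "\<rho> k \<notin> dyadic_interval (Suc n)"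
        using dyadic_interval_disjoint[OF l[OF True], of "Suc n"] by blast
      thus ?thesis using False by (simp add: u_def)
    qed (use l[OF True] in \<open>simp add: u_def\<close>)
    moreover have "(\<lambda>n. if n = l k then ennreal (1 / Suc (l k)) else 0) sums ennreal (1 / Suc (l k))"
      by (rule sums_single)
    ultimately have "(\<lambda>n. u n k) sums ennreal (1 / Suc (l k))" by (simp only:)
    thus ?thesis using True by (simp only: sums_unique[symmetric]) simp
  next
    case False
    have "u n k = 0" for n
    proof -
      have "\<rho> k \<notin> dyadic_interval (Suc n)"
        using False dyadic_interval_Suc_ge_half[of "\<rho> k" n] unfolding J_def by blast
      thus ?thesis by (simp add: u_def)
    qed
    thus ?thesis using False by simp
  qed
  have "(\<Sum>n. ennreal (real (annulus_count \<rho> (Suc n)) / real (Suc n))) = (\<Sum>n. \<integral>\<^sup>+k. u n k \<partial>count_space UNIV)"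
  proof (rule suminf_cong)
    fix n
    have "(\<integral>\<^sup>+k. u n k \<partial>count_space UNIV) = ennreal (1 / Suc n) * emeasure (count_space UNIV) {k. \<rho> k \<in> dyadic_interval (Suc n)}"
      unfolding u_def by (rule nn_integral_cmult_indicator) simp
    also have "\<dots> = ennreal (1 / Suc n) * ennreal (real (annulus_count \<rho> (Suc n)))"
      using fin[of n] by (simp add: annulus_count_def emeasure_count_space_finite ennreal_of_nat_eq_real_of_nat)
    finally show "ennreal (real (annulus_count \<rho> (Suc n)) / real (Suc n)) = (\<integral>\<^sup>+k. u n k \<partial>count_space UNIV)"
      by (simp add: ennreal_mult'[symmetric])
  qed
  also have "\<dots> = (\<integral>\<^sup>+k. (\<Sum>n. u n k) \<partial>count_space UNIV)"
    by (rule nn_integral_suminf[symmetric]) simp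
  also have "\<dots> = (\<integral>\<^sup>+k. ennreal (1 / Suc (l k)) \<partial>count_space J)"
    unfolding total by (rule nn_integral_count_space_indicator[symmetric]) simp
  also have "\<dots> < \<infinity> \<longleftrightarrow> (\<lambda>k. 1 / real (Suc (l k))) summable_on J"
    by (rule summable_on_iff_nn_integral_finite[symmetric]) simp
  also have "\<dots> \<longleftrightarrow> W summable_on J"
  proof -
    have lower: "1 / real (Suc (l k)) \<le> 8 * W k" if "k \<in> J" for k
    proof -
      define K where "K = (kernel_norm (complex_of_real (\<rho> k)))\<^sup>2"
      have "real (Suc (l k)) / 4 \<le> K" "K \<le> 8 * real (Suc (l k))"
        using kernel_norm_square_dyadic_bounds[OF _ l[OF that]] by (simp_all add: K_def)
      moreover have "0 < real (Suc (l k)) / 4" by simp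
      ultimately have "1 / (8 * real (Suc (l k))) \<le> 1 / K" by (intro frac_le) linarith+
      hence "8 * (1 / (8 * real (Suc (l k)))) \<le> 8 * W k"
        unfolding W_def K_def by (intro mult_left_mono) auto
      thus ?thesis by (simp del: of_nat_Suc)
    qed
    have upper: "W k \<le> 4 * (1 / real (Suc (l k)))" if "k \<in> J" for k
    proof -
      have "W k \<le> 1 / (real (Suc (l k)) / 4)"
        unfolding W_def using kernel_norm_square_dyadic_bounds(1)[OF _ l[OF that]]
        by (intro frac_le) simp_all
      thus ?thesis by simp
    qed
    show ?thesis
    proof
      assume "(\<lambda>k. 1 / real (Suc (l k))) summable_on J"
      from summable_on_cmult_right[OF this, of 4] show "W summable_on J"
        by (rule summable_on_comparison_test) (use upper in \<open>simp_all add: W_def\<close>)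
    next
      assume "W summable_on J"
      from summable_on_cmult_right[OF this, of 8] show "(\<lambda>k. 1 / real (Suc (l k))) summable_on J"
        by (rule summable_on_comparison_test) (rule lower, simp_all)
    qed
  qed
  finally show ?thesis by (simp only: J_def W_def)
qed

section \<open>Random points with prescribed radii\<close>

locale random_radial_sequence = prob_space M for M :: "'a measure" +
  fixes \<rho> :: "nat \<Rightarrow> real" and \<theta> :: "nat \<Rightarrow> 'a \<Rightarrow> real"
  assumes radius: "\<And>k. \<rho> k \<in> {0..<1}"
    and indep: "indep_vars (\<lambda>_. borel) \<theta> UNIV"
    and uniform: "\<And>k. distr M lborel (\<theta> k) = uniform_measure lborel {0..2*pi}"
begin

abbreviation pt :: "'a \<Rightarrow> nat \<Rightarrow> complex" where
  "pt \<equiv> random_point \<rho> \<theta>"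

definition weight :: "nat \<Rightarrow> real" where
  "weight k = 1 / (kernel_norm (of_real (\<rho> k)))\<^sup>2"

lemma radius_simps [simp]: "0 \<le> \<rho> k" "\<rho> k < 1"
  using radius[of k] by auto

lemma norm_pt [simp]: "cmod (pt \<omega> k) = \<rho> k"
  by (simp add: random_point_def norm_mult)

lemma weight_nonneg [simp]: "0 \<le> weight k"
  by (simp add: weight_def)

lemma kernel_norm_pt: "1 / (kernel_norm (pt \<omega> k))\<^sup>2 = weight k"
  unfolding weight_def by (subst kernel_norm_radial[of "pt \<omega> k" "of_real (\<rho> k)"]) auto

lemma angle_measurable [measurable]: "\<theta> k \<in> borel_measurable M"
  using indep unfolding indep_vars_def by auto

lemma distr_angle: "distr M borel (\<theta> k) = uniform_measure lborel {0..2*pi}"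
proof -
  have "distr M borel (\<theta> k) = distr M lborel (\<theta> k)" by (rule distr_cong) auto
  thus ?thesis using uniform by simp
qed

lemma joint_angle_distr:
  assumes "j \<noteq> k"
  shows "distr M (borel \<Otimes>\<^sub>M borel) (\<lambda>\<omega>. (\<theta> j \<omega>, \<theta> k \<omega>))
      = uniform_measure lborel {0..2*pi} \<Otimes>\<^sub>M uniform_measure lborel {0..2*pi}"
proof -
  have "indep_var (PiM {j} (\<lambda>_. borel)) (\<lambda>\<omega>. restrict (\<lambda>i. \<theta> i \<omega>) {j})
          (PiM {k} (\<lambda>_. borel)) (\<lambda>\<omega>. restrict (\<lambda>i. \<theta> i \<omega>) {k})"
    using assms by (intro indep_var_restrict[OF indep]) auto
  hence "indep_var borel ((\<lambda>f. f j) \<circ> (\<lambda>\<omega>. restrict (\<lambda>i. \<theta> i \<omega>) {j}))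
          borel ((\<lambda>f. f k) \<circ> (\<lambda>\<omega>. restrict (\<lambda>i. \<theta> i \<omega>) {k}))"
    by (rule indep_var_compose) auto
  hence "indep_var borel (\<theta> j) borel (\<theta> k)" by (simp add: comp_def)
  thus ?thesis using indep_var_distribution_eq distr_angle by metis
qed

lemma kernel_series:
  "(\<lambda>n. (of_real (\<rho> j * \<rho> k) * cis (- s)) ^ n / of_nat (Suc n) * cis (real n * t))
    sums dirichlet_kernel (of_real (\<rho> j) * cis s) (of_real (\<rho> k) * cis t)"
proof -
  have eq: "(cnj (of_real (\<rho> j) * cis s) * (of_real (\<rho> k) * cis t)) ^ n / of_nat (Suc n)
      = (of_real (\<rho> j * \<rho> k) * cis (- s)) ^ n / of_nat (Suc n) * cis (real n * t)" for n
  proof -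
    have "cnj (of_real (\<rho> j) * cis s) * (of_real (\<rho> k) * cis t) = of_real (\<rho> j * \<rho> k) * cis (- s) * cis t"
      by (simp add: cis_cnj)
    thus ?thesis by (simp only: power_mult_distrib[of _ "cis t"] Complex.DeMoivre times_divide_eq_left)
  qed
  have "cmod (of_real (\<rho> i) * cis u) < 1" for i u by (simp add: norm_mult)
  from dirichlet_kernel_sums[OF this this, of j s k t] show ?thesis unfolding eq .
qed

text \<open>A pointwise limit of trigonometric polynomials in the two angles.\<close>

lemma kernel_measurable [measurable]:
  "(\<lambda>p. dirichlet_kernel (of_real (\<rho> j) * cis (fst p)) (of_real (\<rho> k) * cis (snd p)))
    \<in> borel_measurable (borel \<Otimes>\<^sub>M borel)"
proof (rule borel_measurable_LIMSEQ_metric)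
  show "(\<lambda>p. \<Sum>n<N. (of_real (\<rho> j * \<rho> k) * cis (- fst p)) ^ n / of_nat (Suc n) * cis (real n * snd p))
      \<in> borel_measurable (borel \<Otimes>\<^sub>M borel)" for N
    by measurable
qed (use kernel_series in \<open>simp add: sums_def\<close>)

lemma kernel_pt_measurable [measurable]:
  "(\<lambda>\<omega>. dirichlet_kernel (pt \<omega> j) (pt \<omega> k)) \<in> borel_measurable M"
  using measurable_compose[OF measurable_Pair[OF angle_measurable[of j] angle_measurable[of k]] kernel_measurable[of j k]]
  by (simp add: random_point_def)

lemma summable_inverse_squares_Suc: "summable (\<lambda>n. 1 / (real (Suc n))\<^sup>2)"
  using inverse_power_summable[of 2, where 'a = real] by (subst summable_Suc_iff) (simp add: inverse_eq_divide)

text \<open>With one angle fixed, the kernel is a trigonometric series in the other angle whose coefficients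
  are at most \<open>1 / (n + 1)\<close>, whatever the radii.\<close>

lemma kernel_circle_mean_le:
  "(\<integral>\<^sup>+t. ennreal ((cmod (dirichlet_kernel (of_real (\<rho> j) * cis s) (of_real (\<rho> k) * cis t)))\<^sup>2)
      \<partial>uniform_measure lborel {0..2*pi}) \<le> ennreal (\<Sum>n. 1 / (real (Suc n))\<^sup>2)"
proof -
  define b where "b = (\<lambda>n. (of_real (\<rho> j * \<rho> k) * cis (- s)) ^ n / of_nat (Suc n))"
  have r: "\<rho> j * \<rho> k < 1"
    using mult_left_le[of "\<rho> k" "\<rho> j"] radius_simps[of k] radius_simps[of j] by linarith
  have norm_b: "cmod (b n) = (\<rho> j * \<rho> k) ^ n / real (Suc n)" for n
    by (simp add: b_def norm_divide norm_mult norm_power abs_mult del: of_nat_Suc)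
  have pow_le: "(\<rho> j * \<rho> k) ^ n \<le> 1" for n using r by (intro power_le_one) auto
  have b_summable: "summable (\<lambda>n. cmod (b n))"
  proof (rule summable_comparison_test')
    show "summable (\<lambda>n. (\<rho> j * \<rho> k) ^ n)" using r by (intro summable_geometric) simp
    show "norm (cmod (b n)) \<le> (\<rho> j * \<rho> k) ^ n" for n
      using frac_le[of "(\<rho> j * \<rho> k) ^ n" "(\<rho> j * \<rho> k) ^ n" 1 "real (Suc n)"] by (simp add: norm_b)
  qed
  have K: "dirichlet_kernel (of_real (\<rho> j) * cis s) (of_real (\<rho> k) * cis t) = (\<Sum>n. b n * cis (real n * t))" for t
    using sums_unique[OF kernel_series] by (simp only: b_def)
  have [measurable]: "(\<lambda>t. \<Sum>n. b n * cis (real n * t)) \<in> borel_measurable borel"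
    using measurable_compose[OF measurable_Pair[OF measurable_const measurable_ident] kernel_measurable[of j k], of s]
    by (simp add: K)
  have "(\<integral>\<^sup>+t. ennreal ((cmod (\<Sum>n. b n * cis (real n * t)))\<^sup>2) \<partial>uniform_measure lborel {0..2*pi})
      = (\<integral>\<^sup>+t\<in>{0..2*pi}. ennreal ((cmod (\<Sum>n. b n * cis (real n * t)))\<^sup>2) \<partial>lborel) / emeasure lborel {0..2*pi}"
    by (rule nn_integral_uniform_measure) auto
  also have "\<dots> = ennreal (2*pi * (\<Sum>n. (cmod (b n))\<^sup>2)) / ennreal (2*pi)"
    by (simp add: circle_parseval_nn_integral[OF b_summable])
  also have "\<dots> = ennreal (\<Sum>n. (cmod (b n))\<^sup>2)"
    using suminf_nonneg[OF summable_power2[OF b_summable]] by (simp add: divide_ennreal)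
  also have "\<dots> \<le> ennreal (\<Sum>n. 1 / (real (Suc n))\<^sup>2)"
  proof (intro ennreal_leI suminf_le summable_power2 b_summable summable_inverse_squares_Suc)
    fix n
    have "cmod (b n) \<le> 1 / real (Suc n)"
      unfolding norm_b using pow_le[of n] by (intro divide_right_mono) auto
    hence "(cmod (b n))\<^sup>2 \<le> (1 / real (Suc n))\<^sup>2" by (intro power_mono) auto
    thus "(cmod (b n))\<^sup>2 \<le> 1 / (real (Suc n))\<^sup>2" by (simp add: power_divide)
  qed auto
  finally show ?thesis by (simp only: K)
qed

lemma kernel_second_moment_le:
  assumes "j \<noteq> k"
  shows "(\<integral>\<^sup>+\<omega>. ennreal ((cmod (dirichlet_kernel (pt \<omega> j) (pt \<omega> k)))\<^sup>2) \<partial>M) \<le> ennreal (\<Sum>n. 1 / (real (Suc n))\<^sup>2)"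
proof -
  let ?U = "uniform_measure lborel {0..2*pi} :: real measure"
  let ?F = "\<lambda>p. ennreal ((cmod (dirichlet_kernel (of_real (\<rho> j) * cis (fst p)) (of_real (\<rho> k) * cis (snd p))))\<^sup>2)"
  have "prob_space ?U" by (rule prob_space_uniform_measure) auto
  then interpret U: prob_space ?U .
  have F: "?F \<in> borel_measurable (borel \<Otimes>\<^sub>M borel)" by measurable
  have sets: "sets (?U \<Otimes>\<^sub>M ?U) = sets (borel \<Otimes>\<^sub>M borel)"
    by (intro sets_pair_measure_cong) simp_all
  have F': "?F \<in> borel_measurable (?U \<Otimes>\<^sub>M ?U)"
    using F measurable_cong_sets[OF sets refl] by blast
  have "(\<integral>\<^sup>+\<omega>. ennreal ((cmod (dirichlet_kernel (pt \<omega> j) (pt \<omega> k)))\<^sup>2) \<partial>M) = (\<integral>\<^sup>+\<omega>. ?F (\<theta> j \<omega>, \<theta> k \<omega>) \<partial>M)"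
    by (simp add: random_point_def)
  also have "\<dots> = (\<integral>\<^sup>+p. ?F p \<partial>distr M (borel \<Otimes>\<^sub>M borel) (\<lambda>\<omega>. (\<theta> j \<omega>, \<theta> k \<omega>)))"
  proof (rule nn_integral_distr[symmetric])
    show "?F \<in> borel_measurable (distr M (borel \<Otimes>\<^sub>M borel) (\<lambda>\<omega>. (\<theta> j \<omega>, \<theta> k \<omega>)))"
      using F by (simp only: measurable_distr_eq1)
  qed measurable
  also have "\<dots> = (\<integral>\<^sup>+p. ?F p \<partial>(?U \<Otimes>\<^sub>M ?U))" by (simp only: joint_angle_distr[OF assms])
  also have "\<dots> = (\<integral>\<^sup>+s. \<integral>\<^sup>+t. ?F (s, t) \<partial>?U \<partial>?U)" by (rule U.nn_integral_fst[OF F', symmetric])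
  also have "\<dots> \<le> (\<integral>\<^sup>+s. ennreal (\<Sum>n. 1 / (real (Suc n))\<^sup>2) \<partial>?U)"
    using kernel_circle_mean_le by (intro nn_integral_mono) simp
  also have "\<dots> = ennreal (\<Sum>n. 1 / (real (Suc n))\<^sup>2)" by (simp add: U.emeasure_space_1)
  finally show ?thesis .
qed

text \<open>The squared off-diagonal entries of the Gram matrix, indexed by pairs of indices. Their
  normalisation involves the radii only, so it is deterministic.\<close>

definition gram_entry :: "'a \<Rightarrow> nat \<times> nat \<Rightarrow> real" where
  "gram_entry \<omega> = (\<lambda>(j, k). if j = k then 0
     else (cmod (dirichlet_kernel (pt \<omega> k) (pt \<omega> j)))\<^sup>2 * (weight j * weight k))"

lemma gram_entry_measurable [measurable]: "(\<lambda>\<omega>. gram_entry \<omega> p) \<in> borel_measurable M"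
  by (cases p) (simp add: gram_entry_def)

lemma gram_entry_moment_le:
  "(\<integral>\<^sup>+\<omega>. ennreal (gram_entry \<omega> (j, k)) \<partial>M) \<le> ennreal (\<Sum>n. 1 / (real (Suc n))\<^sup>2) * ennreal (weight j * weight k)"
proof (cases "j = k")
  case False
  have "(\<integral>\<^sup>+\<omega>. ennreal (gram_entry \<omega> (j, k)) \<partial>M)
      = (\<integral>\<^sup>+\<omega>. ennreal ((cmod (dirichlet_kernel (pt \<omega> k) (pt \<omega> j)))\<^sup>2) * ennreal (weight j * weight k) \<partial>M)"
    using False by (simp add: gram_entry_def ennreal_mult)
  also have "\<dots> = (\<integral>\<^sup>+\<omega>. ennreal ((cmod (dirichlet_kernel (pt \<omega> k) (pt \<omega> j)))\<^sup>2) \<partial>M) * ennreal (weight j * weight k)"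
    by (rule nn_integral_multc) measurable
  also have "\<dots> \<le> ennreal (\<Sum>n. 1 / (real (Suc n))\<^sup>2) * ennreal (weight j * weight k)"
    using False by (intro mult_right_mono kernel_second_moment_le) auto
  finally show ?thesis .
qed (simp add: gram_entry_def)

text \<open>The expected sum of the entries is at most a constant times \<open>(\<Sum> weight k)\<^sup>2\<close>, and a nonnegative
  function with finite integral is finite almost everywhere.\<close>

lemma AE_gram_summable:
  assumes w: "weight summable_on J"
  shows "AE \<omega> in M. gram_entry \<omega> summable_on J \<times> J"
proof -
  define C where "C = ennreal (\<Sum>n. 1 / (real (Suc n))\<^sup>2)"
  have prod: "(\<lambda>(j, k). weight j * weight k) summable_on J \<times> J"
  proof -
    have "(\<lambda>p. norm ((\<lambda>(j, k). weight j * weight k) p)) summable_on J \<times> J"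
      using w by (subst Infinite_Sum.abs_summable_on_Sigma_iff)
        (auto simp: abs_mult infsum_cmult_right' infsum_nonneg intro!: summable_on_cmult_right summable_on_cmult_left)
    thus ?thesis by (rule abs_summable_summable)
  qed
  have "(\<integral>\<^sup>+\<omega>. \<integral>\<^sup>+p. ennreal (gram_entry \<omega> p) \<partial>count_space (J \<times> J) \<partial>M)
      = (\<integral>\<^sup>+p. \<integral>\<^sup>+\<omega>. ennreal (gram_entry \<omega> p) \<partial>M \<partial>count_space (J \<times> J))"
    by (rule nn_integral_count_space_nn_integral) auto
  also have "\<dots> \<le> (\<integral>\<^sup>+p. C * ennreal ((\<lambda>(j, k). weight j * weight k) p) \<partial>count_space (J \<times> J))"
    using gram_entry_moment_le by (intro nn_integral_mono) (auto simp: C_def)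
  also have "\<dots> = C * (\<integral>\<^sup>+p. ennreal ((\<lambda>(j, k). weight j * weight k) p) \<partial>count_space (J \<times> J))"
    by (rule nn_integral_cmult) simp
  also have "\<dots> < \<infinity>"
  proof -
    have "(\<integral>\<^sup>+p. ennreal ((\<lambda>(j, k). weight j * weight k) p) \<partial>count_space (J \<times> J)) < \<infinity>"
      by (rule summable_on_iff_nn_integral_finite[THEN iffD1, OF _ prod]) auto
    moreover have "C < top" by (simp add: C_def)
    ultimately show ?thesis unfolding infinity_ennreal_def ennreal_mult_less_top by blast
  qed
  finally have "AE \<omega> in M. (\<integral>\<^sup>+p. ennreal (gram_entry \<omega> p) \<partial>count_space (J \<times> J)) \<noteq> \<infinity>"
  proof (intro nn_integral_PInf_AE)
    have "(\<integral>\<^sup>+p. ennreal (gram_entry \<omega> p) \<partial>count_space (J \<times> J))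
        = (\<Sum>n. ennreal (gram_entry \<omega> (prod_decode n)) * indicator (J \<times> J) (prod_decode n))" for \<omega>
    proof -
      have "(\<integral>\<^sup>+p. ennreal (gram_entry \<omega> p) \<partial>count_space (J \<times> J))
          = (\<integral>\<^sup>+p. ennreal (gram_entry \<omega> p) * indicator (J \<times> J) p \<partial>count_space UNIV)"
        by (rule nn_integral_count_space_indicator) simp
      also have "\<dots> = (\<integral>\<^sup>+n. ennreal (gram_entry \<omega> (prod_decode n)) * indicator (J \<times> J) (prod_decode n) \<partial>count_space UNIV)"
        by (rule nn_integral_bij_count_space[OF bij_prod_decode, symmetric])
      finally show ?thesis by (simp only: nn_integral_count_space_nat)
    qed
    thus "(\<lambda>\<omega>. \<integral>\<^sup>+p. ennreal (gram_entry \<omega> p) \<partial>count_space (J \<times> J)) \<in> borel_measurable M"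
      by (simp only:) measurable
  qed simp
  thus ?thesis
  proof eventually_elim
    case (elim \<omega>)
    have "0 \<le> gram_entry \<omega> p" for p by (simp add: gram_entry_def case_prod_beta)
    thus ?case using elim summable_on_iff_nn_integral_finite[of "J \<times> J" "gram_entry \<omega>"]
      by (simp add: less_top)
  qed
qed

text \<open>Restricting to radii at least \<open>1 / 2\<close> leaves out the annulus of index 0, which almost surely
  holds finitely many points of the random set, although infinitely many indices belong to it if
  the radius 0 occurs infinitely often.\<close>

abbreviation outer_indices :: "nat set" where
  "outer_indices \<equiv> {k. 1 / 2 \<le> \<rho> k}"

lemma AE_inj_outer: "AE \<omega> in M. inj_on (pt \<omega>) outer_indices"
  using AE_random_point_distinct[OF prob_space_axioms indep uniform radius_simps(1)]
  by eventually_elim (rule inj_on_subset, auto)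

lemma summable_on_outer_iff:
  assumes inj: "inj_on (pt \<omega>) outer_indices"
  shows "(\<lambda>z. 1 / (kernel_norm z)\<^sup>2) summable_on pt \<omega> ` outer_indices \<longleftrightarrow> weight summable_on outer_indices"
  unfolding summable_on_reindex[OF inj] o_def kernel_norm_pt ..

lemma universal_interpolating_imp_weight_summable:
  assumes inj: "inj_on (pt \<omega>) outer_indices" and UI: "universal_interpolating (random_set \<rho> \<theta> \<omega>)"
  shows "weight summable_on outer_indices"
proof -
  have "(\<lambda>z. 1 / (kernel_norm z)\<^sup>2) summable_on pt \<omega> ` outer_indices"
    by (rule summable_on_subset_banach[OF universal_interpolating_imp_summable[OF UI]])
       (auto simp: random_set_def)
  thus ?thesis by (simp only: summable_on_outer_iff[OF inj])
qed

text \<open>The Hilbert-Schmidt criterion applies to the points of radius at least \<open>1 / 2\<close>. The finitely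
  many others are added afterwards.\<close>

lemma universal_interpolating_if_gram_summable:
  assumes inj: "inj_on (pt \<omega>) outer_indices" and w: "weight summable_on outer_indices"
    and gram: "gram_entry \<omega> summable_on outer_indices \<times> outer_indices"
    and fin: "finite (random_set \<rho> \<theta> \<omega> \<inter> dyadic_annulus 0)"
  shows "universal_interpolating (random_set \<rho> \<theta> \<omega>)"
proof -
  define J where "J = outer_indices"
  define L where "L = pt \<omega> ` J"
  have inj2: "inj_on (map_prod (pt \<omega>) (pt \<omega>)) (J \<times> J)"
    using inj unfolding J_def by (intro map_prod_inj_on)
  have gram_eq: "(cmod (offdiag_gram (pt \<omega> j) (pt \<omega> k)))\<^sup>2 = gram_entry \<omega> (j, k)" if "j \<in> J" "k \<in> J" for j k
  proof (cases "j = k")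
    case False
    hence "pt \<omega> j \<noteq> pt \<omega> k" using inj that unfolding J_def inj_on_def by blast
    thus ?thesis using False
      by (simp add: offdiag_gram_def gram_entry_def norm_divide norm_mult power_divide power_mult_distrib
          kernel_norm_pt[of \<omega>, symmetric])
  qed (simp add: offdiag_gram_def gram_entry_def)
  have "(\<lambda>(z, w). (cmod (offdiag_gram z w))\<^sup>2) summable_on L \<times> L"
  proof -
    have LL: "L \<times> L = map_prod (pt \<omega>) (pt \<omega>) ` (J \<times> J)" by (auto simp: L_def)
    have "(\<lambda>(z, w). (cmod (offdiag_gram z w))\<^sup>2) \<circ> map_prod (pt \<omega>) (pt \<omega>) summable_on J \<times> J"
      using gram unfolding J_def[symmetric]
      by (rule summable_on_cong[THEN iffD1, rotated]) (auto simp: gram_eq)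
    thus ?thesis unfolding LL summable_on_reindex[OF inj2] .
  qed
  moreover have "(\<lambda>z. 1 / (kernel_norm z)\<^sup>2) summable_on L"
    using w unfolding L_def J_def by (simp only: summable_on_outer_iff[OF inj])
  moreover have "L \<subseteq> ball 0 1" by (auto simp: L_def)
  ultimately have UI: "universal_interpolating L"
    by (intro universal_interpolating_if_gram_hilbert_schmidt)
  have "random_set \<rho> \<theta> \<omega> - L \<subseteq> random_set \<rho> \<theta> \<omega> \<inter> dyadic_annulus 0"
  proof
    fix z assume z: "z \<in> random_set \<rho> \<theta> \<omega> - L"
    then obtain k where k: "z = pt \<omega> k" "k \<notin> J" by (auto simp: random_set_def L_def)
    hence "\<rho> k < 1 / 2" by (simp add: J_def)
    thus "z \<in> random_set \<rho> \<theta> \<omega> \<inter> dyadic_annulus 0"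
      using z k by (simp add: dyadic_annulus_def dyadic_interval_def)
  qed
  hence "finite (random_set \<rho> \<theta> \<omega> - L)" using fin by (rule finite_subset)
  moreover have "random_set \<rho> \<theta> \<omega> - L \<subseteq> ball 0 1" by (auto simp: random_set_def)
  ultimately have "universal_interpolating (L \<union> (random_set \<rho> \<theta> \<omega> - L))"
    using UI by (intro universal_interpolating_Un_finite)
  moreover have "L \<union> (random_set \<rho> \<theta> \<omega> - L) = random_set \<rho> \<theta> \<omega>"
    by (auto simp: L_def random_set_def)
  ultimately show ?thesis by simp
qed

text \<open>The two alternatives for the series decide the event outright; the equivalences of the theorem
  follow because an event and its complement cannot both be almost sure.\<close>

lemma zero_one_law:
  assumes fin: "\<And>n. AE \<omega> in M. finite (random_set \<rho> \<theta> \<omega> \<inter> dyadic_annulus n)"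
  defines "S \<equiv> (\<Sum>n. ennreal (real (annulus_count \<rho> (Suc n)) / real (Suc n)))"
  shows "S < \<infinity> \<Longrightarrow> AE \<omega> in M. universal_interpolating (random_set \<rho> \<theta> \<omega>)"
    and "S = \<infinity> \<Longrightarrow> AE \<omega> in M. \<not> universal_interpolating (random_set \<rho> \<theta> \<omega>)"
proof -
  have "finite {k. \<rho> k \<in> dyadic_interval (Suc n)}" for n
  proof -
    have "AE \<omega> in M. finite {k. \<rho> k \<in> dyadic_interval (Suc n)}"
      using fin[of "Suc n"] AE_annulus_count[OF prob_space_axioms indep uniform radius_simps(1)]
      by eventually_elim auto
    thus ?thesis by (simp only: AE_const)
  qed
  hence S_iff: "S < \<infinity> \<longleftrightarrow> weight summable_on outer_indices"
    unfolding S_def weight_def[abs_def] by (intro annulus_count_series_finite_iff) auto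
  show "AE \<omega> in M. universal_interpolating (random_set \<rho> \<theta> \<omega>)" if "S < \<infinity>"
  proof -
    have w: "weight summable_on outer_indices" using that S_iff by simp
    show ?thesis
      using AE_inj_outer AE_gram_summable[OF w] fin[of 0]
      by eventually_elim (rule universal_interpolating_if_gram_summable[OF _ w])
  qed
  show "AE \<omega> in M. \<not> universal_interpolating (random_set \<rho> \<theta> \<omega>)" if "S = \<infinity>"
    using AE_inj_outer
  proof eventually_elim
    case (elim \<omega>)
    have "\<not> weight summable_on outer_indices" using S_iff that by (metis less_irrefl)
    thus ?case using universal_interpolating_imp_weight_summable[OF elim] by blast
  qed
qed

end

theorem theorem1p8:
  fixes M :: "'a measure"
    and \<rho> :: "nat \<Rightarrow> real"
    and \<theta> :: "nat \<Rightarrow> 'a \<Rightarrow> real"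
  assumes "prob_space M"
    and "\<And>k. \<rho> k \<in> {0..<1}"
    and "prob_space.indep_vars M (\<lambda>_. borel) \<theta> UNIV"
    and "\<And>k. distr M lborel (\<theta> k) = uniform_measure lborel {0..2*pi}"
    and "\<And>n. AE \<omega> in M. finite (random_set \<rho> \<theta> \<omega> \<inter> dyadic_annulus n)"
  shows "((AE \<omega> in M. universal_interpolating (random_set \<rho> \<theta> \<omega>))
            \<longleftrightarrow> (\<Sum>n. ennreal (real (annulus_count \<rho> (Suc n)) / real (Suc n))) < \<infinity>)
       \<and> ((AE \<omega> in M. \<not> universal_interpolating (random_set \<rho> \<theta> \<omega>))
            \<longleftrightarrow> (\<Sum>n. ennreal (real (annulus_count \<rho> (Suc n)) / real (Suc n))) = \<infinity>)"
proof -
  interpret prob_space M by fact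
  interpret random_radial_sequence M \<rho> \<theta> by unfold_locales (fact assms)+
  let ?S = "\<Sum>n. ennreal (real (annulus_count \<rho> (Suc n)) / real (Suc n))"
  have not_both: False
    if "AE \<omega> in M. universal_interpolating (random_set \<rho> \<theta> \<omega>)"
      and "AE \<omega> in M. \<not> universal_interpolating (random_set \<rho> \<theta> \<omega>)"
  proof -
    from that have "AE \<omega> in M. False" by eventually_elim blast
    thus False by (simp only: AE_const)
  qed
  have "?S < \<infinity> \<or> ?S = \<infinity>" unfolding infinity_ennreal_def by (metis less_top)
  moreover have "?S \<noteq> \<infinity>" if "?S < \<infinity>" using that by (rule less_imp_neq)
  ultimately show ?thesis using zero_one_law[OF assms(5)] not_both by blast
qed

end
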